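(* Let $\mathbf{X},\mathbf{Y}$ be represented spaces with $\mathbf{X}$ complete. Then the multivalued map $\mathrm{HK}:\mathcal{C}(\mathbf{X},\mathbf{Y}^\nabla)\rightrightarrows\sum_{(\alpha_i)_{i\in\mathbb{N}}\in\mathbf{COrd}^\mathbb{N}}\mathcal{C}(\mathbf{X},\mathfrak{L}_{(\alpha_i)_{i\in\mathbb{N}}}\mathbf{Y})$, where $((\alpha_i)_{i\in\mathbb{N}},g)\in\mathrm{HK}(f)$ iff $f=g$ (as functions $X\to Y$), is computable (on all of $\mathcal{C}(\mathbf{X},\mathbf{Y}^\nabla)$).
   Context: A represented space is a pair $\mathbf{X}=(X,\delta_\mathbf{X})$ with $\delta_\mathbf{X}:\subseteq\mathbb{N}^\mathbb{N}\to X$ a partial surjection; a (multivalued) map is computable if some computable $F:\subseteq\mathbb{N}^\mathbb{N}\to\mathbb{N}^\mathbb{N}$ maps every name of an input to a name of some admissible output. $\mathbf{X}$ is complete if it has a computably equivalent total representation. $\mathcal{C}(\mathbf{X},\mathbf{Y})$ is the represented space of continuous functions, where $0^n1p$ names $f$ iff the $n$-th oracle Turing machine with oracle $p$ computes a realizer of $f$; $\mathbf{COrd}^\mathbb{N}$ means $\mathcal{C}(\mathbb{N},\mathbf{COrd})$. $\mathbf{COrd}=(\mathrm{cord},\delta_{\mathrm{nK}})$ is the set of countable ordinals with $\delta_{\mathrm{nK}}(0p)=0$, $\delta_{\mathrm{nK}}(1p)=\delta_{\mathrm{nK}}(p)+1$, $\delta_{\mathrm{nK}}(2\langle p_0,p_1,\ldots\rangle)=\sup_i\delta_{\mathrm{nK}}(p_i)$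 ($\langle\ldots\rangle$ standard tupling). Let $\Delta:\subseteq\mathbb{N}^\mathbb{N}\to\mathbb{N}^\mathbb{N}$ be defined on sequences with finitely many $0$s, mapping such a sequence to its tail after the last $0$ with every entry decreased by $1$; $\mathbf{Y}^\nabla=(Y,\delta_\mathbf{Y}\circ\Delta)$. For a sequence $(\alpha_i)$ of countable ordinals, $L_{(\alpha_i)}:\subseteq\mathbb{N}^\mathbb{N}\to\mathbb{N}^\mathbb{N}$ has domain the sequences $p$ with finitely many odd entries such that whenever $n<m$, $p(n)=2k+1$, $p(m)=2j+1$, then $\alpha_k>\alpha_j$; for such $p$, with $i_0$ the largest index where $p$ is odd ($i_0=-1$ if none), $L_{(\alpha_i)}(p)(n)=p(i_0+n+1)/2$. $\mathfrak{L}_{(\alpha_i)}\mathbf{Y}=(Y,\delta_\mathbf{Y}\circ L_{(\alpha_i)})$. The dependent sum $\sum_{(\alpha_i)\in\mathbf{COrd}^\mathbb{N}}\mathcal{C}(\mathbf{X},\mathfrak{L}_{(\alpha_i)}\mathbf{Y})$ consists of pairs $((\alpha_i),g)$ with $g\in\mathcal{C}(\mathbf{X},\mathfrak{L}_{(\alpha_i)}\mathbf{Y})$, a name being $\langle p,q\rangle$ with $p$ a name of $(\alpha_i)$ in $\mathbf{COrd}^\mathbb{N}$ and $q$ a name of $g$ in $\mathcal{C}(\mathbf{X},\mathfrak{L}_{(\alpha_i)}\mathbf{Y})$. *)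

theory Defs
  imports "HOL-Library.Nat_Bijection" "HOL-Library.FuncSet" "HOL-Library.Countable_Set_Type"
begin

type_synonym baire = "nat \<Rightarrow> nat"

definition pfun_of :: "('p \<Rightarrow> 'x \<Rightarrow> bool) \<Rightarrow> 'p \<rightharpoonup> 'x" where
  "pfun_of R p = (if \<exists>x. R p x then Some (THE x. R p x) else None)"

lemma pfun_of_eq_Some_iff:
  assumes "\<And>p x y. R p x \<Longrightarrow> R p y \<Longrightarrow> x = y"
  shows "pfun_of R p = Some x \<longleftrightarrow> R p x"
proof -
  have "(THE x. R p x) = x" if "R p x" for x
    using that assms by blast
  then show ?thesis
    unfolding pfun_of_def by auto
qed

text \<open>
  Multi-tape machines with finitely many control states and an oracle in Baire space.  Tapes are
  infinite in both directions; a pair \<open>(l, r)\<close> stands for the tape whose cells to the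
  left of the head are \<open>l\<close> (nearest cell first) and whose cells from the head position
  onwards are \<open>r\<close>, all remaining cells being blank (symbol \<open>0\<close>).
  The control states of a machine are the positions of a finite list. A state \<open>Scan t d\<close>
  reads the symbol \<open>a\<close> under the head of tape \<open>t\<close>; the entry \<open>d ! a = (b, m, q)\<close>
  says to write \<open>b\<close>, to move that head by \<open>m\<close> and to change to state \<open>q\<close>.
  A state \<open>Query q\<close> consults the oracle and changes to \<open>q\<close>. The machine halts when no
  action is specified.
\<close>

type_synonym tape = "nat list \<times> nat list"

datatype move = Lft | Stay | Rgt

datatype action = Scan nat "(nat \<times> move \<times> nat) list" | Query nat

type_synonym otm = "action list"

type_synonym config = "nat \<times> (nat \<Rightarrow> tape)"

fun head :: "nat list \<Rightarrow> nat" where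
  "head [] = 0"
| "head (a # as) = a"

fun write_move :: "nat \<Rightarrow> move \<Rightarrow> tape \<Rightarrow> tape" where
  "write_move b Lft (l, r) = (tl l, head l # b # tl r)"
| "write_move b Stay (l, r) = (l, b # tl r)"
| "write_move b Rgt (l, r) = (b # l, tl r)"

text \<open>
  Numbers are written in unary: a tape holds the number of symbols \<open>1\<close> on it. Tape \<open>0\<close>
  carries the input and the output, tape \<open>1\<close> is the query tape: a query with \<open>k\<close> on
  the query tape replaces its content by \<open>p k\<close>, where \<open>p\<close> is the oracle.
\<close>

definition unary :: "nat \<Rightarrow> tape" where
  "unary n = (replicate n 1, [])"

definition tape_val :: "tape \<Rightarrow> nat" where
  "tape_val T = count_list (fst T @ snd T) 1"

fun step :: "otm \<Rightarrow> baire \<Rightarrow> config \<Rightarrow> config option" where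
  "step M p (q, T) =
    (if q < length M then
       (case M ! q of
          Scan t d \<Rightarrow>
            (let a = head (snd (T t)) in
             if a < length d
             then (case d ! a of (b, m, q') \<Rightarrow> Some (q', T(t := write_move b m (T t))))
             else None)
        | Query q' \<Rightarrow> Some (q', T(1 := unary (p (tape_val (T 1))))))
     else None)"

definition init :: "nat \<Rightarrow> config" where
  "init n = (0, (\<lambda>_. ([], []))(0 := unary n))"

definition outputs :: "otm \<Rightarrow> baire \<Rightarrow> nat \<Rightarrow> nat \<Rightarrow> bool" where
  "outputs M p n m \<longleftrightarrow>
    (\<exists>c. (\<lambda>c c'. step M p c = Some c')\<^sup>*\<^sup>* (init n) c \<and> step M p c = None \<and> tape_val (snd c 0) = m)"

lemma outputs_unique:
  assumes "outputs M p n m" "outputs M p n m'"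
  shows "m = m'"
proof -
  have aux: "b = c"
    if "(\<lambda>c c'. step M p c = Some c')\<^sup>*\<^sup>* a b" "step M p b = None"
       "(\<lambda>c c'. step M p c = Some c')\<^sup>*\<^sup>* a c" "step M p c = None" for a b c
    using that
  proof (induction rule: converse_rtranclp_induct)
    case base
    from base(2) show ?case
      by (cases rule: converse_rtranclpE) (use base in auto)
  next
    case (step y z)
    from step(5) show ?case
      by (cases rule: converse_rtranclpE) (use step in auto)
  qed
  show ?thesis
    using assms unfolding outputs_def by (metis aux)
qed

definition move_of :: "nat \<Rightarrow> move" where
  "move_of n = (if n = 0 then Lft else if n = 1 then Stay else Rgt)"

definition entry_of :: "nat \<Rightarrow> nat \<times> move \<times> nat" where
  "entry_of n = (case prod_decode n of (b, k) \<Rightarrow> case prod_decode k of (m, q) \<Rightarrow> (b, move_of m, q))"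

definition action_of :: "nat \<Rightarrow> action" where
  "action_of n =
    (case sum_decode n of
       Inl k \<Rightarrow> (case prod_decode k of (t, d) \<Rightarrow> Scan t (map entry_of (list_decode d)))
     | Inr q \<Rightarrow> Query q)"

definition machine :: "nat \<Rightarrow> otm" where
  "machine n = map action_of (list_decode n)"

text \<open>Only computable coding functions are involved, so this is an effective numbering.\<close>

lemma surj_machine: "surj machine"
proof -
  have "\<exists>n. entry_of n = (b, m, q)" for b m q
  proof -
    have "\<exists>j. move_of j = m"
      by (cases m) (auto simp: move_of_def intro: exI[of _ 0] exI[of _ 1] exI[of _ 2])
    then obtain j where "move_of j = m" ..
    then have "entry_of (prod_encode (b, prod_encode (j, q))) = (b, m, q)"
      by (simp add: entry_of_def)
    then show ?thesis ..
  qed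
  then have entry: "surj entry_of"
    unfolding surj_def by (metis prod.exhaust)
  have "\<exists>n. action_of n = c" for c
  proof (cases c)
    case (Scan t d)
    obtain e where "d = map entry_of e"
      using entry ex_map_conv[of d entry_of] by (metis surjD)
    then have "action_of (sum_encode (Inl (prod_encode (t, list_encode e)))) = c"
      by (simp add: action_of_def Scan)
    then show ?thesis ..
  next
    case (Query q)
    then have "action_of (sum_encode (Inr q)) = c"
      by (simp add: action_of_def)
    then show ?thesis ..
  qed
  then have "surj action_of"
    unfolding surj_def by metis
  then have "\<exists>e. M = map action_of e" for M
    using ex_map_conv[of M action_of] by (metis surjD)
  then have "\<exists>n. machine n = M" for M
    by (metis list_encode_inverse machine_def)
  then show ?thesis
    unfolding surj_def by metis
qed

text \<open>The partial function on Baire space computed by the \<open>n\<close>-th machine: its value at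
  \<open>p\<close> is the sequence that the machine computes digit by digit with oracle \<open>p\<close>.\<close>

definition Phi :: "nat \<Rightarrow> baire \<rightharpoonup> baire" where
  "Phi n = pfun_of (\<lambda>p q. \<forall>i. outputs (machine n) p i (q i))"

lemma Phi_eq_Some_iff: "Phi n p = Some q \<longleftrightarrow> (\<forall>i. outputs (machine n) p i (q i))"
  unfolding Phi_def by (rule pfun_of_eq_Some_iff) (rule ext, blast intro: outputs_unique)

definition computable :: "(baire \<rightharpoonup> baire) \<Rightarrow> bool" where
  "computable F \<longleftrightarrow> (\<exists>n. F \<subseteq>\<^sub>m Phi n)"

definition bpair :: "baire \<Rightarrow> baire \<Rightarrow> baire" where
  "bpair p q n = (if even n then p (n div 2) else q (n div 2))"

definition bfst :: "baire \<Rightarrow> baire" where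
  "bfst p n = p (2 * n)"

definition bsnd :: "baire \<Rightarrow> baire" where
  "bsnd p n = p (2 * n + 1)"

lemma bfst_bpair [simp]: "bfst (bpair p q) = p"
  and bsnd_bpair [simp]: "bsnd (bpair p q) = q"
  and bpair_bfst_bsnd [simp]: "bpair (bfst r) (bsnd r) = r"
  by (auto simp: bfst_def bsnd_def bpair_def fun_eq_iff)

definition btuple :: "(nat \<Rightarrow> baire) \<Rightarrow> baire" where
  "btuple P n = (case prod_decode n of (i, j) \<Rightarrow> P i j)"

definition bcons :: "nat \<Rightarrow> baire \<Rightarrow> baire" where
  "bcons a p n = (case n of 0 \<Rightarrow> a | Suc k \<Rightarrow> p k)"

text \<open>A represented space is given by its representation alone, since the underlying set is the
  range of the representation.\<close>

type_synonym 'a rep_space = "baire \<rightharpoonup> 'a"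

abbreviation points :: "'a rep_space \<Rightarrow> 'a set" where
  "points \<equiv> ran"

text \<open>A multivalued map from \<open>X\<close> to \<open>Y\<close> sends each point to its set of admissible
  values; its domain consists of the points where this set is nonempty.\<close>

definition mv_computable :: "'a rep_space \<Rightarrow> 'b rep_space \<Rightarrow> ('a \<Rightarrow> 'b set) \<Rightarrow> bool" where
  "mv_computable X Y R \<longleftrightarrow>
    (\<exists>F. computable F \<and>
      (\<forall>p x. X p = Some x \<longrightarrow> R x \<noteq> {} \<longrightarrow>
        (\<exists>q y. F p = Some q \<and> Y q = Some y \<and> y \<in> R x)))"

definition rep_equivalent :: "'a rep_space \<Rightarrow> 'a rep_space \<Rightarrow> bool" where
  "rep_equivalent X X' \<longleftrightarrow>
    points X = points X' \<and> mv_computable X X' (\<lambda>x. {x}) \<and> mv_computable X' X (\<lambda>x. {x})"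

definition complete_space :: "'a rep_space \<Rightarrow> bool" where
  "complete_space X \<longleftrightarrow> (\<exists>X'. dom X' = UNIV \<and> rep_equivalent X X')"

definition realizes :: "(baire \<rightharpoonup> baire) \<Rightarrow> 'a rep_space \<Rightarrow> 'b rep_space \<Rightarrow> ('a \<Rightarrow> 'b) \<Rightarrow> bool" where
  "realizes F X Y f \<longleftrightarrow> (\<forall>r x. X r = Some x \<longrightarrow> (\<exists>s. F r = Some s \<and> Y s = Some (f x)))"

text \<open>The sequence \<open>0\<^sup>n 1 p\<close>.\<close>

definition fname :: "nat \<Rightarrow> baire \<Rightarrow> baire" where
  "fname n p i = (if i < n then 0 else if i = n then 1 else p (i - Suc n))"

text \<open>A machine with oracle \<open>p\<close> that works on the argument \<open>r\<close> is run with access to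
  the pair \<open>bpair p r\<close>. Functions between the underlying sets are extensional, so that
  they are determined by their values on \<open>points X\<close>.\<close>

definition cont_names :: "'a rep_space \<Rightarrow> 'b rep_space \<Rightarrow> baire \<Rightarrow> ('a \<Rightarrow> 'b) \<Rightarrow> bool" where
  "cont_names X Y t f \<longleftrightarrow>
    f \<in> points X \<rightarrow>\<^sub>E points Y \<and>
    (\<exists>n p. t = fname n p \<and> realizes (\<lambda>r. Phi n (bpair p r)) X Y f)"

definition cont_space :: "'a rep_space \<Rightarrow> 'b rep_space \<Rightarrow> ('a \<Rightarrow> 'b) rep_space" where
  "cont_space X Y = pfun_of (cont_names X Y)"

lemma fname_inject:
  assumes "fname n p = fname m q"
  shows "n = m \<and> p = q"
proof -
  have "n = m"
  proof (rule ccontr)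
    assume "n \<noteq> m"
    then consider "n < m" | "m < n" by linarith
    then show False
      using fun_cong[OF assms, of n] fun_cong[OF assms, of m]
      by cases (auto simp: fname_def)
  qed
  moreover have "p i = q i" for i
    using fun_cong[OF assms, of "Suc n + i"] \<open>n = m\<close> by (simp add: fname_def)
  ultimately show ?thesis by auto
qed

lemma cont_space_eq_Some_iff: "cont_space X Y t = Some f \<longleftrightarrow> cont_names X Y t f"
  unfolding cont_space_def
proof (rule pfun_of_eq_Some_iff)
  fix t f g
  assume f: "cont_names X Y t f" and g: "cont_names X Y t g"
  obtain n p where n: "t = fname n p" "realizes (\<lambda>r. Phi n (bpair p r)) X Y f"
    using f by (auto simp: cont_names_def)
  obtain m q where m: "t = fname m q" "realizes (\<lambda>r. Phi m (bpair q r)) X Y g"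
    using g by (auto simp: cont_names_def)
  have *: "m = n" "q = p"
    using fname_inject n(1) m(1) by metis+
  have "f x = g x" if x: "x \<in> points X" for x
  proof -
    obtain r where "X r = Some x"
      using x by (auto simp: ran_def)
    then show ?thesis
      using n(2) m(2) unfolding realizes_def * by fastforce
  qed
  moreover have "f \<in> extensional (points X)" "g \<in> extensional (points X)"
    using f g by (auto simp: cont_names_def PiE_def)
  ultimately show "f = g"
    by (meson extensionalityI)
qed

definition nat_space :: "nat rep_space" where
  "nat_space p = Some (p 0)"

text \<open>The countable ordinals are the elements of the first uncountable ordinal.\<close>

typedef cord = "Field (cardSuc natLeq)"
  morphisms cord_rep cord_abs
proof -
  have "infinite (Field (cardSuc natLeq))"
    using cardSuc_finite[OF natLeq_Card_order] by (simp add: Field_natLeq)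
  then show ?thesis
    by (metis all_not_in_conv finite.emptyI)
qed

instantiation cord :: wellorder
begin

definition less_eq_cord :: "cord \<Rightarrow> cord \<Rightarrow> bool" where
  "a \<le> b \<longleftrightarrow> (cord_rep a, cord_rep b) \<in> cardSuc natLeq"

definition less_cord :: "cord \<Rightarrow> cord \<Rightarrow> bool" where
  "a < b \<longleftrightarrow> a \<le> b \<and> a \<noteq> b" for a b :: cord

instance
proof
  have wo: "Well_order (cardSuc natLeq)"
    using cardSuc_Card_order natLeq_Card_order card_order_on_well_order_on by blast
  then have refl: "Refl (cardSuc natLeq)" and tr: "trans (cardSuc natLeq)"
    and anti: "antisym (cardSuc natLeq)" and tot: "Total (cardSuc natLeq)"
    and wf: "wf (cardSuc natLeq - Id)"
    by (auto simp: well_order_on_def linear_order_on_def partial_order_on_def preorder_on_def)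
  fix x y z :: cord
  show le_refl: "x \<le> x"
    using refl cord_rep unfolding less_eq_cord_def refl_on_def by blast
  show "x \<le> z" if "x \<le> y" "y \<le> z"
    using that tr unfolding less_eq_cord_def trans_def by blast
  show le_antisym: "x = y" if "x \<le> y" "y \<le> x"
    using that anti unfolding less_eq_cord_def antisym_def by (metis cord_rep_inject)
  show "(x < y) = (x \<le> y \<and> \<not> y \<le> x)"
    using anti refl cord_rep unfolding less_cord_def less_eq_cord_def antisym_def refl_on_def
    by (metis cord_rep_inject)
  show "x \<le> y \<or> y \<le> x"
    using tot refl cord_rep[of x] cord_rep[of y]
    unfolding less_eq_cord_def total_on_def refl_on_def by metis
  fix P :: "cord \<Rightarrow> bool" and a :: cord
  assume step: "\<And>x. (\<And>y. y < x \<Longrightarrow> P y) \<Longrightarrow> P x"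
  have "wf (inv_image (cardSuc natLeq - Id) cord_rep)"
    using wf by (rule wf_inv_image)
  then show "P a"
  proof (induction a rule: wf_induct_rule)
    case (less x)
    show ?case
      by (rule step, rule less) (auto simp: less_cord_def less_eq_cord_def cord_rep_inject)
  qed
qed

end

lemma countable_lessThan_cord:
  includes cardinal_syntax
  shows "countable {..<a :: cord}"
proof -
  have "cord_rep ` {..<a} \<subseteq> underS (cardSuc natLeq) (cord_rep a)"
    by (auto simp: underS_def less_cord_def less_eq_cord_def cord_rep_inject)
  moreover have "|underS (cardSuc natLeq) (cord_rep a)| <o cardSuc natLeq"
    by (rule card_of_underS) (use cord_rep cardSuc_Card_order natLeq_Card_order in auto)
  then have "|underS (cardSuc natLeq) (cord_rep a)| \<le>o natLeq"
    by (simp add: cardSuc_ordLeq_ordLess natLeq_Card_order card_of_Card_order)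
  then have "countable (underS (cardSuc natLeq) (cord_rep a))"
    by (simp add: countable_card_le_natLeq)
  ultimately have "countable (cord_rep ` {..<a})"
    using countable_subset by blast
  then show ?thesis
    by (rule countable_image_inj_on) (simp add: inj_on_def cord_rep_inject)
qed

lemma uncountable_cord:
  includes cardinal_syntax
  shows "uncountable (UNIV :: cord set)"
proof
  assume "countable (UNIV :: cord set)"
  then have "countable (range cord_rep)"
    by simp
  then have "|Field (cardSuc natLeq)| \<le>o natLeq"
    by (simp add: countable_card_le_natLeq type_definition.Rep_range[OF type_definition_cord])
  moreover have "|Field (cardSuc natLeq)| =o cardSuc natLeq"
    by (simp add: card_of_Field_ordIso cardSuc_Card_order natLeq_Card_order)
  moreover have "natLeq <o cardSuc natLeq"
    by (simp add: cardSuc_greater natLeq_Card_order)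
  ultimately show False
    by (metis not_ordLess_ordLeq ordLess_ordIso_trans ordIso_symmetric)
qed

definition ord_zero :: cord where
  "ord_zero = (LEAST a. True)"

definition ord_succ :: "cord \<Rightarrow> cord" where
  "ord_succ a = (LEAST b. a < b)"

definition ord_sup :: "(nat \<Rightarrow> cord) \<Rightarrow> cord" where
  "ord_sup A = (LEAST b. \<forall>i. A i \<le> b)"

lemma ord_bounded: "\<exists>b. \<forall>i :: nat. (A i :: cord) < b"
proof -
  have "countable (\<Union>i. {..A i})"
  proof -
    have "{..A i} = insert (A i) {..<A i}" for i
      by auto
    then show ?thesis
      by (simp add: countable_lessThan_cord)
  qed
  then have "(\<Union>i. {..A i}) \<noteq> UNIV"
    using uncountable_cord by metis
  then obtain b where "b \<notin> (\<Union>i. {..A i})"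
    by blast
  then show ?thesis
    by (auto simp: not_le)
qed

lemma ord_zero_le: "ord_zero \<le> a"
  unfolding ord_zero_def by (rule Least_le) simp

lemma less_ord_succ: "a < ord_succ a"
  unfolding ord_succ_def by (rule LeastI_ex) (use ord_bounded[of "\<lambda>_. a"] in auto)

lemma ord_succ_le_iff: "ord_succ a \<le> b \<longleftrightarrow> a < b"
  using less_ord_succ[of a] Least_le[of "\<lambda>b. a < b" b] unfolding ord_succ_def by fastforce

lemma le_ord_sup: "A i \<le> ord_sup A"
proof -
  have "\<exists>b. \<forall>i. A i \<le> b"
    using ord_bounded[of A] less_imp_le by blast
  then have "\<forall>i. A i \<le> ord_sup A"
    unfolding ord_sup_def by (rule LeastI_ex)
  then show ?thesis ..
qed

lemma ord_sup_le_iff: "ord_sup A \<le> b \<longleftrightarrow> (\<forall>i. A i \<le> b)"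
proof
  assume "ord_sup A \<le> b"
  then show "\<forall>i. A i \<le> b"
    using le_ord_sup order_trans by blast
next
  assume "\<forall>i. A i \<le> b"
  then show "ord_sup A \<le> b"
    unfolding ord_sup_def by (rule Least_le)
qed

inductive nK :: "baire \<Rightarrow> cord \<Rightarrow> bool" where
  zero: "nK (bcons 0 p) ord_zero"
| succ: "nK p a \<Longrightarrow> nK (bcons 1 p) (ord_succ a)"
| sup: "(\<And>i. nK (P i) (A i)) \<Longrightarrow> nK (bcons 2 (btuple P)) (ord_sup A)"

definition cord_space :: "cord rep_space" where
  "cord_space = pfun_of nK"

lemma bcons_eq_iff: "bcons a p = bcons b q \<longleftrightarrow> a = b \<and> p = q"
proof
  assume eq: "bcons a p = bcons b q"
  have "p i = q i" for i
    using fun_cong[OF eq, of "Suc i"] by (simp add: bcons_def)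
  then show "a = b \<and> p = q"
    using fun_cong[OF eq, of 0] by (auto simp: bcons_def)
qed simp

lemma btuple_eq_iff: "btuple P = btuple Q \<longleftrightarrow> P = Q"
proof
  assume eq: "btuple P = btuple Q"
  have "P i j = Q i j" for i j
    using fun_cong[OF eq, of "prod_encode (i, j)"] by (simp add: btuple_def)
  then show "P = Q"
    by blast
qed simp

lemma nK_unique: "nK p a \<Longrightarrow> nK p b \<Longrightarrow> a = b"
proof (induction arbitrary: b rule: nK.induct)
  case (zero p)
  then show ?case
    by cases (auto simp: bcons_eq_iff)
next
  case (succ p a)
  from succ.prems show ?case
    by cases (use succ.IH in \<open>auto simp: bcons_eq_iff\<close>)
next
  case (sup P A)
  from sup.prems show ?case
  proof cases
    case (sup Q B)
    then have "P = Q"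
      by (simp add: bcons_eq_iff btuple_eq_iff)
    then have "A i = B i" for i
      using sup.IH sup(3) by blast
    then have "A = B"
      by blast
    then show ?thesis
      using sup by simp
  qed (auto simp: bcons_eq_iff)
qed

lemma cord_space_eq_Some_iff: "cord_space p = Some a \<longleftrightarrow> nK p a"
  unfolding cord_space_def by (rule pfun_of_eq_Some_iff) (rule nK_unique)

lemma points_cord_space: "points cord_space = UNIV"
proof -
  have "\<exists>p. nK p a" for a
  proof (induction a rule: less_induct)
    case (less a)
    show ?case
    proof (cases "{..<a} = {}")
      case True
      then have "a = ord_zero"
        using ord_zero_le[of a] by (metis lessThan_iff empty_iff order_le_less)
      then show ?thesis
        using nK.zero by blast
    next
      case False
      define B where "B = from_nat_into {..<a}"
      have B: "range B = {..<a}"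
        unfolding B_def using False countable_lessThan_cord by (rule range_from_nat_into)
      then have "B i < a" for i
        by (metis lessThan_iff rangeI)
      then have "\<forall>i. \<exists>p. nK p (B i)"
        using less.IH by blast
      then obtain P where "nK (P i) (B i)" for i
        by metis
      then have "nK (bcons 2 (btuple (\<lambda>i. bcons 1 (P i)))) (ord_sup (\<lambda>i. ord_succ (B i)))"
        by (intro nK.intros)
      moreover have "ord_sup (\<lambda>i. ord_succ (B i)) = a"
      proof (rule order_antisym)
        show "ord_sup (\<lambda>i. ord_succ (B i)) \<le> a"
          using \<open>\<And>i. B i < a\<close> by (simp add: ord_sup_le_iff ord_succ_le_iff)
        show "a \<le> ord_sup (\<lambda>i. ord_succ (B i))"
        proof (rule ccontr)
          assume "\<not> a \<le> ord_sup (\<lambda>i. ord_succ (B i))"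
          then obtain i where "B i = ord_sup (\<lambda>i. ord_succ (B i))"
            using B by (metis imageE lessThan_iff not_le)
          then show False
            using less_ord_succ[of "B i"] le_ord_sup[of "\<lambda>i. ord_succ (B i)" i] by simp
        qed
      qed
      ultimately show ?thesis
        by metis
    qed
  qed
  then show ?thesis
    by (auto simp: ran_def cord_space_eq_Some_iff)
qed

definition after_last :: "nat set \<Rightarrow> nat" where
  "after_last I = (if I = {} then 0 else Suc (Max I))"

definition Delta :: "baire \<rightharpoonup> baire" where
  "Delta p =
    (if finite {i. p i = 0} then Some (\<lambda>n. p (after_last {i. p i = 0} + n) - 1) else None)"

definition nabla :: "'b rep_space \<Rightarrow> 'b rep_space" where
  "nabla Y = Y \<circ>\<^sub>m Delta"

definition Lmap :: "(nat \<Rightarrow> cord) \<Rightarrow> baire \<rightharpoonup> baire" where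
  "Lmap \<alpha> p =
    (if finite {i. odd (p i)} \<and>
        (\<forall>n m k j. n < m \<and> p n = 2 * k + 1 \<and> p m = 2 * j + 1 \<longrightarrow> \<alpha> k > \<alpha> j)
     then Some (\<lambda>n. p (after_last {i. odd (p i)} + n) div 2)
     else None)"

definition Lspace :: "(nat \<Rightarrow> cord) \<Rightarrow> 'b rep_space \<Rightarrow> 'b rep_space" where
  "Lspace \<alpha> Y = Y \<circ>\<^sub>m Lmap \<alpha>"

definition sum_space :: "'i rep_space \<Rightarrow> ('i \<Rightarrow> 'c rep_space) \<Rightarrow> ('i \<times> 'c) rep_space" where
  "sum_space A B r =
    (case A (bfst r) of
       None \<Rightarrow> None
     | Some a \<Rightarrow> (case B a (bsnd r) of None \<Rightarrow> None | Some b \<Rightarrow> Some (a, b)))"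

definition HK_source :: "'a rep_space \<Rightarrow> 'b rep_space \<Rightarrow> ('a \<Rightarrow> 'b) rep_space" where
  "HK_source X Y = cont_space X (nabla Y)"

definition HK_target :: "'a rep_space \<Rightarrow> 'b rep_space \<Rightarrow> ((nat \<Rightarrow> cord) \<times> ('a \<Rightarrow> 'b)) rep_space" where
  "HK_target X Y = sum_space (cont_space nat_space cord_space) (\<lambda>\<alpha>. cont_space X (Lspace \<alpha> Y))"

definition HK :: "'a rep_space \<Rightarrow> 'b rep_space \<Rightarrow> ('a \<Rightarrow> 'b) \<Rightarrow> ((nat \<Rightarrow> cord) \<times> ('a \<Rightarrow> 'b)) set" where
  "HK X Y f = {(\<alpha>, g). (\<alpha>, g) \<in> points (HK_target X Y) \<and> f = g}"

end

theory Submission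
  imports Defs
begin

text \<open>
  Let \<open>t\<close> name \<open>f\<close>. As \<open>X\<close> is complete, every
  \<open>s\<close> in Baire space can be read as a name of a point, so the machine named by
  \<open>t\<close> turns every \<open>s\<close> into a sequence with finitely many zeros. Consider the
  finite segments of \<open>bpair t s\<close> that suffice to compute a digit \<open>0\<close> of this
  sequence. Since no \<open>s\<close> yields infinitely many zeros, passing from such a segment to one that
  extends it and establishes a later zero is well-founded. The ranks are the ordinals
  \<open>\<alpha>\<close>, and their names can be computed because the relation is decidable from
  \<open>t\<close>. A name of \<open>f x\<close> in the ordinal-bounded space arises by replacing each
  zero by the code of a segment that establishes it. One machine has to serve all \<open>t\<close>, which
  requires a universal machine.
\<close>

section \<open>Counter programs with an oracle\<close>

text \<open>The ordinals must be fixed from \<open>t\<close> before any point is given. They are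
  therefore indexed by all node codes at once, with the odd half of a segment left free to range
  over all \<open>s\<close> and only the even half tied to \<open>t\<close>. Decidability of the
  child relation rests on running the named machine for a number of steps bounded by the length of
  the segment instead of waiting for it to halt. In this way every ingredient is a primitive
  recursive function of finite segments, and one search over ever longer segments
  (\<open>approximates_Phi\<close>) turns such a function into a machine. Work with concrete Turing
  machines is thereby confined to compiling primitive recursion and that one loop. The output merely
  wraps \<open>t\<close>: a name of a function carries its own oracle, so \<open>fname m t\<close>
  and \<open>fname m' t\<close> with fixed \<open>m\<close> and \<open>m'\<close> postpone all
  computation until the sequence of ordinals or the function is evaluated.\<close>

datatype com = Inc nat | Dec nat | Ask | Seq com com | If nat com com | While nat com

text \<open>Registers correspond to tapes, so \<open>Ask\<close> is tied to register
  \<open>1\<close>, the query tape. A big-step relation describes halting runs only, which is all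
  that \<open>outputs\<close> asks for.\<close>

inductive exec :: "baire \<Rightarrow> com \<Rightarrow> (nat \<Rightarrow> nat) \<Rightarrow> (nat \<Rightarrow> nat) \<Rightarrow> bool" for p where
  Inc: "exec p (Inc r) s (s(r := Suc (s r)))"
| Dec: "exec p (Dec r) s (s(r := s r - 1))"
| Ask: "exec p Ask s (s(1 := p (s 1)))"
| Seq: "exec p c s t \<Longrightarrow> exec p d t u \<Longrightarrow> exec p (Seq c d) s u"
| IfT: "s r \<noteq> 0 \<Longrightarrow> exec p c s t \<Longrightarrow> exec p (If r c d) s t"
| IfF: "s r = 0 \<Longrightarrow> exec p d s t \<Longrightarrow> exec p (If r c d) s t"
| WhileF: "s r = 0 \<Longrightarrow> exec p (While r c) s s"
| WhileT: "s r \<noteq> 0 \<Longrightarrow> exec p c s t \<Longrightarrow> exec p (While r c) t u \<Longrightarrow> exec p (While r c) s u"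

text \<open>Turns the syntactic shape of the final state into an equation between stores, to be
  proved separately.\<close>

lemma exec_eq: "exec p c s t \<Longrightarrow> t = u \<Longrightarrow> exec p c s u"
  by simp

fun code_size :: "com \<Rightarrow> nat" where
  "code_size (Inc r) = 1"
| "code_size (Dec r) = 2"
| "code_size Ask = 1"
| "code_size (Seq c d) = code_size c + code_size d"
| "code_size (If r c d) = 3 + code_size c + code_size d"
| "code_size (While r c) = 3 + code_size c"

text \<open>Register \<open>r\<close> is kept on tape \<open>r\<close>, with the head to the right of all symbols
  \<open>1\<close>. The second argument is the position of the first instruction.\<close>

fun compile :: "com \<Rightarrow> nat \<Rightarrow> otm" where
  "compile (Inc r) i = [Scan r [(1, Rgt, i + 1)]]"
| "compile (Dec r) i = [Scan r [(0, Lft, i + 1)], Scan r [(0, Rgt, i + 2), (0, Stay, i + 2)]]"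
| "compile Ask i = [Query (i + 1)]"
| "compile (Seq c d) i = compile c i @ compile d (i + code_size c)"
| "compile (If r c d) i =
    [Scan r [(0, Lft, i + 1)],
     Scan r [(0, Rgt, i + 3 + code_size c), (1, Rgt, i + 2)]] @
    compile c (i + 2) @ [Scan r [(0, Stay, i + 3 + code_size c + code_size d)]] @
    compile d (i + 3 + code_size c)"
| "compile (While r c) i =
    [Scan r [(0, Lft, i + 1)],
     Scan r [(0, Rgt, i + 3 + code_size c), (1, Rgt, i + 2)]] @
    compile c (i + 2) @ [Scan r [(0, Stay, i)]]"

section \<open>Correctness of the compilation to oracle machines\<close>

lemma length_compile [simp]: "length (compile c i) = code_size c"
  by (induction c arbitrary: i) auto

text \<open>Moving past the end of a list creates explicit blanks, so the tape for a number is
  determined only up to blanks: \<open>a\<close> counts those at the far left, \<open>b\<close>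
  those from the head onwards.\<close>

definition holds_number :: "tape \<Rightarrow> nat \<Rightarrow> bool" where
  "holds_number T n \<longleftrightarrow> (\<exists>a b. T = (replicate n 1 @ replicate a 0, replicate b 0))"

definition segment :: "otm \<Rightarrow> nat \<Rightarrow> otm \<Rightarrow> bool" where
  "segment M i C \<longleftrightarrow> (\<forall>k<length C. i + k < length M \<and> M ! (i + k) = C ! k)"

lemma segment_Nil [simp]: "segment M i []"
  by (simp add: segment_def)

lemma segment_Cons:
  "segment M i (a # C) \<longleftrightarrow> i < length M \<and> M ! i = a \<and> segment M (Suc i) C"
  by (auto simp: segment_def All_less_Suc2)

lemma segment_append:
  "segment M i (C @ D) \<longleftrightarrow> segment M i C \<and> segment M (i + length C) D"
  by (induction C arbitrary: i) (auto simp: segment_Cons)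

abbreviation moves :: "otm \<Rightarrow> baire \<Rightarrow> config \<Rightarrow> config \<Rightarrow> bool" where
  "moves M p \<equiv> (\<lambda>c c'. step M p c = Some c')\<^sup>*\<^sup>*"

lemma moves1: "step M p c = Some e \<Longrightarrow> moves M p c e"
  by blast

lemma moves2: "Option.bind (step M p c) (step M p) = Some e \<Longrightarrow> moves M p c e"
  by (auto simp: bind_eq_Some_conv simp del: step.simps intro: converse_rtranclp_into_rtranclp)

lemma holds_number_head: "holds_number T n \<Longrightarrow> head (snd T) = 0"
  by (auto simp: holds_number_def) (metis head.simps replicate_empty list.exhaust replicate_Suc not0_implies_Suc)

lemma head_replicate_0 [simp]: "head (replicate b 0) = 0"
  by (cases b) auto

lemma Cons_replicate: "\<exists>b'. a # replicate b a = replicate b' a"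
  by (intro exI[of _ "Suc b"]) simp

lemma holds_number_Inc: "holds_number T n \<Longrightarrow> holds_number (write_move 1 Rgt T) (Suc n)"
  by (auto simp: holds_number_def)

lemma holds_number_Stay: "holds_number T n \<Longrightarrow> holds_number (write_move 0 Stay T) n"
  unfolding holds_number_def
  by (auto simp flip: replicate_Suc)

lemma head_Lft: "holds_number T n \<Longrightarrow> head (snd (write_move 0 Lft T)) = (if n = 0 then 0 else 1)"
  by (cases n) (auto simp: holds_number_def)

lemma holds_number_Lft_0:
  "holds_number T 0 \<Longrightarrow> holds_number (write_move 0 Rgt (write_move 0 Lft T)) 0"
  unfolding holds_number_def by (auto simp flip: replicate_Suc)

lemma holds_number_Lft_1:
  "holds_number T n \<Longrightarrow> n \<noteq> 0 \<Longrightarrow> holds_number (write_move 1 Rgt (write_move 0 Lft T)) n"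
  unfolding holds_number_def by (cases n) (auto simp: Cons_replicate)

lemma holds_number_Lft_Stay:
  "holds_number T n \<Longrightarrow> n \<noteq> 0 \<Longrightarrow> holds_number (write_move 0 Stay (write_move 0 Lft T)) (n - 1)"
  unfolding holds_number_def by (cases n) (auto simp flip: replicate_Suc)

lemma tape_val_holds_number: "holds_number T n \<Longrightarrow> tape_val T = n"
proof -
  have "count_list (replicate k a) b = (if a = b then k else 0)" for k a b :: nat
    by (induction k) auto
  then show "holds_number T n \<Longrightarrow> tape_val T = n"
    by (auto simp: holds_number_def tape_val_def)
qed

lemma holds_number_unary: "holds_number (unary n) n"
  by (auto simp: holds_number_def unary_def)

text \<open>The head rests on a blank, so a zero test has to step left, read, and step back while
  restoring the symbol. Both \<open>If\<close> and \<open>While\<close> open with this pair of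
  states.\<close>

lemma branch_moves:
  assumes "segment M i [Scan r [(0, Lft, i + 1)], Scan r [(0, Rgt, j), (1, Rgt, k)]]"
    and "\<forall>r. holds_number (T r) (s r)"
  shows "\<exists>T'. (\<forall>r. holds_number (T' r) (s r)) \<and>
    moves M p (i, T) (if s r = 0 then j else k, T')"
proof -
  have *: "holds_number (T r) (s r)"
    using assms(2) by blast
  show ?thesis
  proof (cases "s r = 0")
  case True
  then show ?thesis
    using assms holds_number_head[OF *] head_Lft[OF *] *
    by (intro exI[of _ "T(r := write_move 0 Rgt (write_move 0 Lft (T r)))"])
      (auto simp: segment_Cons holds_number_Lft_0 simp del: write_move.simps
        intro!: moves2)
next
  case False
  then show ?thesis
    using assms holds_number_head[OF *] head_Lft[OF *] *
    by (intro exI[of _ "T(r := write_move 1 Rgt (write_move 0 Lft (T r)))"])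
      (auto simp: segment_Cons holds_number_Lft_1[simplified] simp del: write_move.simps
        intro!: moves2)
  qed
qed

lemma jump_moves:
  assumes "segment M i [Scan r [(0, Stay, j)]]" and "\<forall>r. holds_number (T r) (s r)"
  shows "\<exists>T'. (\<forall>r. holds_number (T' r) (s r)) \<and> moves M p (i, T) (j, T')"
  using assms holds_number_head[of "T r" "s r"]
  by (intro exI[of _ "T(r := write_move 0 Stay (T r))"])
    (auto simp: segment_Cons holds_number_Stay simp del: write_move.simps
      intro!: moves1)

text \<open>Jump targets are absolute. The claim is therefore made for code sitting at any position
  \<open>i\<close> of a larger machine \<open>M\<close>, so that the induction applies to
  subprograms and to the repeated run of a loop.\<close>

lemma compile_moves:
  assumes "exec p c s t" "segment M i (compile c i)" "\<forall>r. holds_number (T r) (s r)"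
  shows "\<exists>T'. (\<forall>r. holds_number (T' r) (t r)) \<and> moves M p (i, T) (i + code_size c, T')"
  using assms
proof (induction arbitrary: i T rule: exec.induct)
  case (Inc r s)
  then show ?case
    using holds_number_head[of "T r" "s r"]
    by (intro exI[of _ "T(r := write_move 1 Rgt (T r))"])
      (auto simp: segment_Cons holds_number_Inc[simplified] fun_eq_iff simp del: write_move.simps
        intro!: moves1)
next
  case (Dec r s)
  have *: "holds_number (T r) (s r)"
    using Dec.prems(2) by blast
  show ?case
  proof (cases "s r = 0")
    case True
    then show ?thesis
      using Dec.prems(1) holds_number_head[OF *] head_Lft[OF *] * Dec.prems(2)
      by (intro exI[of _ "T(r := write_move 0 Rgt (write_move 0 Lft (T r)))"])
        (auto simp: segment_Cons holds_number_Lft_0 fun_eq_iff simp del: write_move.simps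
          intro!: moves2)
  next
    case False
    then show ?thesis
      using Dec holds_number_head[of "T r" "s r"] head_Lft[of "T r" "s r"]
        holds_number_Lft_Stay[of "T r" "s r"]
      by (intro exI[of _ "T(r := write_move 0 Stay (write_move 0 Lft (T r)))"])
        (auto simp: segment_Cons fun_eq_iff simp del: write_move.simps
          intro!: moves2)
  qed
next
  case (Ask s)
  then show ?case
    using holds_number_unary tape_val_holds_number[of "T 1" "s 1"]
    by (intro exI[of _ "T(1 := unary (p (s 1)))"])
      (auto simp: segment_Cons fun_eq_iff intro!: moves1)
next
  case (Seq c s t d u)
  have seg: "segment M i (compile c i)" "segment M (i + code_size c) (compile d (i + code_size c))"
    using Seq.prems by (auto simp: segment_append)
  obtain T1 where T1: "\<forall>r. holds_number (T1 r) (t r)" "moves M p (i, T) (i + code_size c, T1)"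
    using Seq.IH(1)[OF seg(1) Seq.prems(2)] by blast
  obtain T2 where "\<forall>r. holds_number (T2 r) (u r)"
    "moves M p (i + code_size c, T1) (i + code_size c + code_size d, T2)"
    using Seq.IH(2)[OF seg(2) T1(1)] by blast
  moreover have eq: "i + code_size (Seq c d) = i + code_size c + code_size d"
    by simp
  ultimately show ?case
    unfolding eq using rtranclp_trans[OF T1(2)] by blast
next
  case (IfT s r c t d)
  have seg: "segment M i [Scan r [(0, Lft, i + 1)], Scan r [(0, Rgt, i + 3 + code_size c), (1, Rgt, i + 2)]]"
    "segment M (i + 2) (compile c (i + 2))"
    "segment M (i + 2 + code_size c) [Scan r [(0, Stay, i + 3 + code_size c + code_size d)]]"
    using IfT.prems by (auto simp: segment_append segment_Cons)
  obtain T0 where T0: "\<forall>r. holds_number (T0 r) (s r)" "moves M p (i, T) (i + 2, T0)"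
    using branch_moves[OF seg(1) IfT.prems(2), of p] IfT.hyps by auto
  obtain T1 where T1: "\<forall>r. holds_number (T1 r) (t r)"
    "moves M p (i + 2, T0) (i + 2 + code_size c, T1)"
    using IfT.IH[OF seg(2) T0(1)] by blast
  obtain T2 where "\<forall>r. holds_number (T2 r) (t r)"
    "moves M p (i + 2 + code_size c, T1) (i + 3 + code_size c + code_size d, T2)"
    using jump_moves[OF seg(3) T1(1), of p] by blast
  moreover have eq: "i + code_size (If r c d) = i + 3 + code_size c + code_size d"
    by simp
  ultimately show ?case
    unfolding eq using rtranclp_trans[OF T0(2) rtranclp_trans[OF T1(2)]] by blast
next
  case (IfF s r d t c)
  have seg: "segment M i [Scan r [(0, Lft, i + 1)], Scan r [(0, Rgt, i + 3 + code_size c), (1, Rgt, i + 2)]]"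
    "segment M (i + 3 + code_size c) (compile d (i + 3 + code_size c))"
    using IfF.prems by (auto simp: segment_append segment_Cons eval_nat_numeral)
  obtain T0 where T0: "\<forall>r. holds_number (T0 r) (s r)" "moves M p (i, T) (i + 3 + code_size c, T0)"
    using branch_moves[OF seg(1) IfF.prems(2), of p] IfF.hyps by auto
  obtain T1 where "\<forall>r. holds_number (T1 r) (t r)"
    "moves M p (i + 3 + code_size c, T0) (i + 3 + code_size c + code_size d, T1)"
    using IfF.IH[OF seg(2) T0(1)] by blast
  moreover have eq: "i + code_size (If r c d) = i + 3 + code_size c + code_size d"
    by simp
  ultimately show ?case
    unfolding eq using rtranclp_trans[OF T0(2)] by blast
next
  case (WhileF s r c)
  then have seg: "segment M i [Scan r [(0, Lft, i + 1)], Scan r [(0, Rgt, i + 3 + code_size c), (1, Rgt, i + 2)]]"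
    by (auto simp: segment_append segment_Cons)
  then show ?case
    using branch_moves[OF seg WhileF.prems(2), of p] WhileF.hyps by (auto simp: add.assoc)
next
  case (WhileT s r c t u)
  have seg: "segment M i [Scan r [(0, Lft, i + 1)], Scan r [(0, Rgt, i + 3 + code_size c), (1, Rgt, i + 2)]]"
    "segment M (i + 2) (compile c (i + 2))"
    "segment M (i + 2 + code_size c) [Scan r [(0, Stay, i)]]"
    using WhileT.prems by (auto simp: segment_append segment_Cons)
  obtain T0 where T0: "\<forall>r. holds_number (T0 r) (s r)" "moves M p (i, T) (i + 2, T0)"
    using branch_moves[OF seg(1) WhileT.prems(2), of p] WhileT.hyps by auto
  obtain T1 where T1: "\<forall>r. holds_number (T1 r) (t r)"
    "moves M p (i + 2, T0) (i + 2 + code_size c, T1)"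
    using WhileT.IH(1)[OF seg(2) T0(1)] by blast
  obtain T2 where T2: "\<forall>r. holds_number (T2 r) (t r)"
    "moves M p (i + 2 + code_size c, T1) (i, T2)"
    using jump_moves[OF seg(3) T1(1), of p] by blast
  obtain T3 where "\<forall>r. holds_number (T3 r) (u r)"
    "moves M p (i, T2) (i + code_size (While r c), T3)"
    using WhileT.IH(2)[OF WhileT.prems(1) T2(1)] by blast
  then show ?case
    using rtranclp_trans[OF T0(2) rtranclp_trans[OF T1(2) rtranclp_trans[OF T2(2)]]] by blast
qed

text \<open>The run ends in state \<open>code_size c\<close>, one past the last instruction, where
  \<open>step\<close> is undefined.\<close>

lemma compile_outputs:
  assumes "exec p c ((\<lambda>_. 0)(0 := n)) t"
  shows "outputs (compile c 0) p n (t 0)"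
proof -
  have "segment (compile c 0) 0 (compile c 0)"
    by (auto simp: segment_def)
  moreover have "\<forall>r. holds_number (((\<lambda>_. ([], []))(0 := unary n)) r) (((\<lambda>_. 0)(0 := n)) r)"
    using holds_number_unary by (auto simp: holds_number_def)
  ultimately obtain T where "\<forall>r. holds_number (T r) (t r)"
    "moves (compile c 0) p (init n) (code_size c, T)"
    using compile_moves[OF assms, of "compile c 0" 0] unfolding init_def by (metis add_0)
  then show ?thesis
    unfolding outputs_def by (intro exI[of _ "(code_size c, T)"]) (auto simp: tape_val_holds_number)
qed

section \<open>Primitive recursive functions\<close>

text \<open>A basis for primitive recursion with one argument only: pairing replaces tuples, and
  plain iteration replaces the recursion scheme, which is recovered in \<open>prim_rec_nat\<close>.
  This leaves few cases to compile.\<close>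

inductive primrec1 :: "(nat \<Rightarrow> nat) \<Rightarrow> bool" where
  zero: "primrec1 (\<lambda>n. 0)"
| ident: "primrec1 (\<lambda>n. n)"
| suc: "primrec1 Suc"
| left: "primrec1 (\<lambda>n. fst (prod_decode n))"
| right: "primrec1 (\<lambda>n. snd (prod_decode n))"
| pair: "primrec1 f \<Longrightarrow> primrec1 g \<Longrightarrow> primrec1 (\<lambda>n. prod_encode (f n, g n))"
| comp: "primrec1 f \<Longrightarrow> primrec1 g \<Longrightarrow> primrec1 (\<lambda>n. f (g n))"
| iter: "primrec1 f \<Longrightarrow> primrec1 (\<lambda>n. (f ^^ snd (prod_decode n)) (fst (prod_decode n)))"

section \<open>Counter programs for pairing and iteration\<close>

definition clear :: "nat \<Rightarrow> com" where
  "clear a = While a (Dec a)"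

definition add_to :: "nat \<Rightarrow> nat \<Rightarrow> com" where
  "add_to a b = While a (Seq (Dec a) (Inc b))"

definition copy_to :: "nat \<Rightarrow> nat \<Rightarrow> nat \<Rightarrow> com" where
  "copy_to a b c = Seq (While a (Seq (Dec a) (Seq (Inc b) (Inc c)))) (add_to c a)"

lemma exec_clear: "exec p (clear a) s (s(a := 0))"
proof (induction "s a" arbitrary: s)
  case 0
  then show ?case
    unfolding clear_def by (intro exec_eq[OF exec.WhileF]) (auto simp: fun_eq_iff)
next
  case (Suc n)
  have "exec p (clear a) (s(a := s a - 1)) ((s(a := s a - 1))(a := 0))"
    using Suc by (metis diff_Suc_1 fun_upd_same)
  then show ?case
    using Suc(2) unfolding clear_def by (auto intro: exec.WhileT exec.Dec)
qed

lemma exec_add_to: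
  assumes "a \<noteq> b"
  shows "exec p (add_to a b) s (s(a := 0, b := s b + s a))"
proof (induction "s a" arbitrary: s)
  case 0
  then show ?case
    unfolding add_to_def by (intro exec_eq[OF exec.WhileF]) (auto simp: fun_eq_iff)
next
  case (Suc n)
  let ?s = "s(a := s a - 1, b := Suc (s b))"
  have *: "exec p (add_to a b) ?s (?s(a := 0, b := ?s b + ?s a))"
    using Suc assms by (intro Suc(1)) auto
  have "exec p (Seq (Dec a) (Inc b)) s ?s"
    using assms by (auto intro!: exec.Seq[OF exec.Dec] exec_eq[OF exec.Inc])
  with * show ?case
    unfolding add_to_def using Suc(2) assms
    by (intro exec.WhileT[of s a]) (auto intro: exec_eq)
qed

lemma exec_copy_to:
  assumes "a \<noteq> b" "a \<noteq> c" "b \<noteq> c" "s c = 0"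
  shows "exec p (copy_to a b c) s (s(b := s b + s a))"
proof -
  have "exec p (While a (Seq (Dec a) (Seq (Inc b) (Inc c)))) s
    (s(a := 0, b := s b + s a, c := s c + s a))" for s
  proof (induction "s a" arbitrary: s)
    case 0
    then show ?case
      by (intro exec_eq[OF exec.WhileF]) (auto simp: fun_eq_iff)
  next
    case (Suc n)
    let ?s = "s(a := s a - 1, b := Suc (s b), c := Suc (s c))"
    have *: "exec p (While a (Seq (Dec a) (Seq (Inc b) (Inc c)))) ?s
        (?s(a := 0, b := ?s b + ?s a, c := ?s c + ?s a))"
      using Suc assms by (intro Suc(1)) auto
    have "exec p (Seq (Dec a) (Seq (Inc b) (Inc c))) s ?s"
      using assms by (auto intro!: exec.Seq[OF exec.Dec] exec.Seq[OF exec.Inc] exec_eq[OF exec.Inc])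
    with * show ?case
      using Suc(2) assms by (intro exec.WhileT[of s a]) (auto intro: exec_eq)
  qed
  then show ?thesis
    unfolding copy_to_def using assms
    by (intro exec.Seq) (assumption | rule exec_eq[OF exec_add_to] | auto)+
qed

text \<open>Follows \<open>prod_encode (x, y) = triangle (x + y) + x\<close>: register
  \<open>b + 2\<close> starts with \<open>x\<close>, register \<open>b + 1\<close> is raised to
  \<open>x + y\<close>, and the loop adds \<open>x + y\<close>, \<open>x + y - 1\<close>, and so on
  down to \<open>1\<close>.\<close>

definition encode_pair :: "nat \<Rightarrow> com" where
  "encode_pair b = Seq (copy_to b (b + 2) (b + 3)) (Seq (add_to b (b + 1))
    (Seq (While (b + 1) (Seq (copy_to (b + 1) (b + 2) (b + 3)) (Dec (b + 1)))) (add_to (b + 2) b)))"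

lemma exec_encode_pair:
  assumes "s (b + 2) = 0" "s (b + 3) = 0"
  shows "exec p (encode_pair b) s (s(b := prod_encode (s b, s (b + 1)), b + 1 := 0))"
proof -
  let ?c = "Seq (copy_to (b + 1) (b + 2) (b + 3)) (Dec (b + 1))"
  have loop: "exec p (While (b + 1) ?c) s
    (s(b + 1 := 0, b + 2 := s (b + 2) + triangle (s (b + 1))))" if "s (b + 3) = 0" for s
    using that
  proof (induction "s (b + 1)" arbitrary: s)
    case 0
    then show ?case
      by (intro exec_eq[OF exec.WhileF]) (auto simp: fun_eq_iff)
  next
    case (Suc n)
    let ?s = "s(b + 2 := s (b + 2) + s (b + 1), b + 1 := n)"
    have n: "s (Suc b) = Suc n"
      using Suc by simp
    have "exec p (While (b + 1) ?c) ?s (?s(b + 1 := 0, b + 2 := ?s (b + 2) + triangle (?s (b + 1))))"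
      using Suc by (intro Suc(1)) auto
    moreover have "exec p ?c s ?s"
      using Suc(3) n
      by (intro exec.Seq[OF exec_copy_to exec_eq[OF exec.Dec]]) auto
    ultimately show ?case
      using n by (intro exec.WhileT[of s "b + 1"]) (auto intro: exec_eq simp: ac_simps)
  qed
  show ?thesis
    unfolding encode_pair_def using assms
    by (intro exec.Seq[OF exec_copy_to] exec.Seq[OF exec_add_to] exec.Seq[OF loop]
        exec_eq[OF exec_add_to]) (auto simp: prod_encode_def fun_eq_iff add.commute)
qed

text \<open>Moves to the successor in the enumeration of pairs along the diagonals.\<close>

definition next_pair :: "nat \<Rightarrow> com" where
  "next_pair b = If (b + 1) (Seq (Dec (b + 1)) (Inc b)) (Seq (Inc (b + 1)) (add_to b (b + 1)))"

lemma prod_decode_Suc: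
  assumes "prod_decode n = (x, y)"
  shows "prod_decode (Suc n) = (if y = 0 then (0, Suc x) else (Suc x, y - 1))"
proof -
  have "n = prod_encode (x, y)"
    using assms by (metis prod_decode_inverse)
  then have "Suc n = prod_encode (if y = 0 then (0, Suc x) else (Suc x, y - 1))"
    by (cases y) (auto simp: prod_encode_def)
  then show ?thesis
    by simp
qed

lemma exec_next_pair:
  assumes "prod_decode n = (s b, s (b + 1))"
  shows "exec p (next_pair b) s
    (s(b := fst (prod_decode (Suc n)), b + 1 := snd (prod_decode (Suc n))))"
proof (cases "s (b + 1) = 0")
  case True
  then show ?thesis
    unfolding next_pair_def using prod_decode_Suc[OF assms]
    by (intro exec.IfF exec.Seq[OF exec.Inc] exec_eq[OF exec_add_to]) (auto simp: fun_eq_iff)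
next
  case False
  then show ?thesis
    unfolding next_pair_def using prod_decode_Suc[OF assms]
    by (intro exec.IfT exec.Seq[OF exec.Dec] exec_eq[OF exec.Inc]) (auto simp: fun_eq_iff)
qed

definition decode_pair :: "nat \<Rightarrow> com" where
  "decode_pair b = While b (Seq (Dec b) (next_pair (b + 1)))"

lemma exec_decode_pair:
  assumes "s (b + 1) = 0" "s (b + 2) = 0"
  shows "exec p (decode_pair b) s
    (s(b := 0, b + 1 := fst (prod_decode (s b)), b + 2 := snd (prod_decode (s b))))"
proof -
  \<comment> \<open>The loop is generalised to start at the pair with any index \<open>m\<close>;
    zeroed registers represent the pair with index \<open>0\<close>.\<close>
  have "exec p (decode_pair b) s
      (s(b := 0, b + 1 := fst (prod_decode (m + s b)), b + 2 := snd (prod_decode (m + s b))))"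
    if "prod_decode m = (s (b + 1), s (b + 2))" for m s
    using that
  proof (induction "s b" arbitrary: s m)
    case 0
    then show ?case
      unfolding decode_pair_def by (intro exec_eq[OF exec.WhileF]) (auto simp: fun_eq_iff)
  next
    case (Suc n)
    let ?s = "s(b := n, b + 1 := fst (prod_decode (Suc m)), b + 2 := snd (prod_decode (Suc m)))"
    have *: "exec p (decode_pair b) ?s
      (?s(b := 0, b + 1 := fst (prod_decode (Suc m + ?s b)), b + 2 := snd (prod_decode (Suc m + ?s b))))"
      using Suc by (intro Suc(1)) auto
    have **: "exec p (Seq (Dec b) (next_pair (b + 1))) s ?s"
      using Suc(2,3)
      by (intro exec.Seq[OF exec.Dec] exec_eq[OF exec_next_pair[of m]]) (auto simp: fun_eq_iff)
    show ?case
      using Suc(2)[symmetric] exec.WhileT[OF _ ** exec_eq[OF *[unfolded decode_pair_def]]]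
      unfolding decode_pair_def by (simp add: fun_eq_iff)
  qed
  from this[of 0] show ?thesis
    using assms by (simp add: prod_decode_def prod_decode_aux.simps)
qed

text \<open>A program for a function gets the number of its argument register and may use all later
  registers as workspace.\<close>

definition implements :: "(nat \<Rightarrow> com) \<Rightarrow> (nat \<Rightarrow> nat) \<Rightarrow> bool" where
  "implements P f \<longleftrightarrow>
    (\<forall>p b s. (\<forall>r>b. s r = 0) \<longrightarrow> exec p (P b) s (s(b := f (s b))))"

lemma implementsD:
  "implements P f \<Longrightarrow> (\<And>r. r > b \<Longrightarrow> s r = 0) \<Longrightarrow> exec p (P b) s (s(b := f (s b)))"
  by (simp add: implements_def)

lemma primrec1_implements: "primrec1 f \<Longrightarrow> \<exists>P. implements P f"
proof (induction rule: primrec1.induct)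
  case zero
  have "implements clear (\<lambda>n. 0)"
    using exec_clear by (auto simp: implements_def)
  then show ?case by blast
next
  case ident
  \<comment> \<open>The language has no empty program; an increment followed by a decrement replaces
    it.\<close>
  have "exec p (Seq (Inc b) (Dec b)) s (s(b := s b))" for p b s
    by (auto intro!: exec.Seq[OF exec.Inc] exec_eq[OF exec.Dec])
  then show ?case
    by (auto simp: implements_def intro!: exI[of _ "\<lambda>b. Seq (Inc b) (Dec b)"])
next
  case suc
  have "implements Inc Suc"
    using exec.Inc by (auto simp: implements_def)
  then show ?case by blast
next
  case left
  have "implements (\<lambda>b. Seq (decode_pair b) (Seq (add_to (b + 1) b) (clear (b + 2))))
    (\<lambda>n. fst (prod_decode n))"
    unfolding implements_def
    by (intro allI impI exec.Seq[OF exec_decode_pair] exec.Seq[OF exec_add_to]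
        exec_eq[OF exec_clear]) (auto simp: fun_eq_iff)
  then show ?case by blast
next
  case right
  have "implements (\<lambda>b. Seq (decode_pair b) (Seq (add_to (b + 2) b) (clear (b + 1))))
    (\<lambda>n. snd (prod_decode n))"
    unfolding implements_def
    by (intro allI impI exec.Seq[OF exec_decode_pair] exec.Seq[OF exec_add_to]
        exec_eq[OF exec_clear]) (auto simp: fun_eq_iff)
  then show ?case by blast
next
  case (pair f g)
  then obtain P Q where PQ: "implements P f" "implements Q g"
    by blast
  have "implements (\<lambda>b. Seq (copy_to b (b + 1) (b + 2)) (Seq (P (b + 1)) (Seq (add_to b (b + 2))
    (Seq (Q (b + 2)) (Seq (encode_pair (b + 1)) (add_to (b + 1) b)))))) (\<lambda>n. prod_encode (f n, g n))"
    unfolding implements_def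
    by (intro allI impI exec.Seq[OF exec_copy_to] exec.Seq[OF exec_add_to]
        exec.Seq[OF implementsD[OF PQ(1)]] exec.Seq[OF implementsD[OF PQ(2)]]
        exec.Seq[OF exec_encode_pair] exec_eq[OF exec_add_to]) (auto simp: fun_eq_iff)
  then show ?case by blast
next
  case (comp f g)
  then obtain P Q where PQ: "implements P f" "implements Q g"
    by blast
  have "implements (\<lambda>b. Seq (Q b) (P b)) (\<lambda>n. f (g n))"
    unfolding implements_def
    by (intro allI impI exec.Seq[OF implementsD[OF PQ(2)]] exec_eq[OF implementsD[OF PQ(1)]]) auto
  then show ?case by blast
next
  case (iter f)
  then obtain P where P: "implements P f"
    by blast
  have loop: "exec p (While b (Seq (Dec b) (P (b + 1)))) s
      (s(b := 0, b + 1 := (f ^^ s b) (s (b + 1))))" if "\<And>r. r > b + 1 \<Longrightarrow> s r = 0" for p b s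
    using that
  proof (induction "s b" arbitrary: s)
    case 0
    then show ?case
      by (intro exec_eq[OF exec.WhileF]) (auto simp: fun_eq_iff)
  next
    case (Suc n)
    let ?s = "s(b := n, b + 1 := f (s (b + 1)))"
    have *: "exec p (While b (Seq (Dec b) (P (b + 1)))) ?s (?s(b := 0, b + 1 := (f ^^ ?s b) (?s (b + 1))))"
      using Suc by (intro Suc(1)) auto
    have **: "exec p (Seq (Dec b) (P (b + 1))) s ?s"
      using Suc(2)[symmetric] Suc(3)
      by (intro exec.Seq[OF exec.Dec] exec_eq[OF implementsD[OF P]]) auto
    show ?case
      using Suc(2)[symmetric] exec.WhileT[OF _ ** exec_eq[OF *]]
      by (simp add: fun_eq_iff funpow_Suc_right del: funpow.simps)
  qed
  have "implements (\<lambda>b. Seq (decode_pair b) (Seq (add_to (b + 2) b)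
    (Seq (While b (Seq (Dec b) (P (b + 1)))) (add_to (b + 1) b))))
    (\<lambda>n. (f ^^ snd (prod_decode n)) (fst (prod_decode n)))"
    unfolding implements_def
    by (intro allI impI exec.Seq[OF exec_decode_pair] exec.Seq[OF exec_add_to]
        exec.Seq[OF loop] exec_eq[OF exec_add_to]) (auto simp: fun_eq_iff)
  then show ?case by blast
qed

section \<open>Primitive recursion on coded data\<close>

class coded =
  fixes code :: "'a \<Rightarrow> nat"

instantiation nat :: coded
begin
definition code_nat :: "nat \<Rightarrow> nat" where [simp]: "code_nat n = n"
instance ..
end

instantiation bool :: coded
begin
definition code_bool :: "bool \<Rightarrow> nat" where [simp]: "code_bool b = of_bool b"
instance ..
end

instantiation prod :: (coded, coded) coded
begin
definition code_prod :: "'a \<times> 'b \<Rightarrow> nat" where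
  "code_prod z = prod_encode (code (fst z), code (snd z))"
instance ..
end

instantiation option :: (coded) coded
begin
definition code_option :: "'a option \<Rightarrow> nat" where
  "code_option z = (case z of None \<Rightarrow> 0 | Some x \<Rightarrow> Suc (code x))"
instance ..
end

instantiation list :: (coded) coded
begin
definition code_list :: "'a list \<Rightarrow> nat" where
  "code_list l = list_encode (map code l)"
instance ..
end

lemma code_Pair [simp]: "code (x, y) = prod_encode (code x, code y)"
  by (simp add: code_prod_def)

lemma code_None [simp]: "code None = 0"
  and code_Some [simp]: "code (Some x) = Suc (code x)"
  by (simp_all add: code_option_def)

lemma code_Nil [simp]: "code [] = 0"
  and code_Cons [simp]: "code (x # l) = Suc (prod_encode (code x, code l))"
  by (simp_all add: code_list_def)

lemma code_nat_list [simp]: "code (l :: nat list) = list_encode l"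
  by (simp add: code_list_def map_idI)

text \<open>With this notion the rules \<open>prim_intros\<close> establish computability by
  following the syntax of a definition. Later definitions are written to fit: bounded
  \<open>LEAST\<close>, \<open>lookup\<close> with an option result, explicit projections.\<close>

definition prim :: "('a::coded \<Rightarrow> 'b::coded) \<Rightarrow> bool" where
  "prim f \<longleftrightarrow> (\<exists>g. primrec1 g \<and> (\<forall>x. g (code x) = code (f x)))"

lemma primE:
  assumes "prim f"
  obtains g where "primrec1 g" "\<And>x. g (code x) = code (f x)"
  using assms unfolding prim_def by blast

lemma prim_nat_iff: "prim f \<longleftrightarrow> primrec1 f" for f :: "nat \<Rightarrow> nat"
proof
  assume "prim f"
  then obtain g where "primrec1 g" "\<And>n :: nat. g n = f n"
    by (auto elim: primE)
  then show "primrec1 f"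
    by (metis ext)
next
  assume "primrec1 f"
  then show "prim f"
    unfolding prim_def by (intro exI[of _ f]) simp
qed

named_theorems prim_intros

lemma prim_comp:
  assumes "prim f" "prim g"
  shows "prim (\<lambda>x. f (g x))"
  using assms unfolding prim_def by (metis primrec1.comp)

lemma prim_id [prim_intros]: "prim (\<lambda>x. x)"
  unfolding prim_def by (intro exI[of _ "\<lambda>n. n"]) (auto intro: primrec1.intros)

lemma prim_const [prim_intros]: "prim (\<lambda>_. c)"
proof -
  have "primrec1 (\<lambda>_. n)" for n
    using primrec1.zero primrec1.comp[OF primrec1.suc] by (induction n) auto
  then show ?thesis
    unfolding prim_def by blast
qed

lemma prim_Pair [prim_intros]:
  assumes "prim f" "prim g"
  shows "prim (\<lambda>x. (f x, g x))"
proof -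
  obtain f' g' where "primrec1 f'" "\<And>x. f' (code x) = code (f x)"
    "primrec1 g'" "\<And>x. g' (code x) = code (g x)"
    using assms by (metis primE)
  then show ?thesis
    unfolding prim_def by (intro exI[of _ "\<lambda>n. prod_encode (f' n, g' n)"]) (auto intro: primrec1.pair)
qed

text \<open>Many constructors and projections act on codes as one basic function, often the
  identity.\<close>

lemma prim_recode:
  assumes "prim f" "primrec1 h" "\<And>x. h (code (f x)) = code (g x)"
  shows "prim g"
proof -
  obtain f' where "primrec1 f'" "\<And>x. f' (code x) = code (f x)"
    using assms(1) by (metis primE)
  then show ?thesis
    unfolding prim_def using assms(2,3)
    by (intro exI[of _ "\<lambda>n. h (f' n)"]) (auto intro: primrec1.comp)
qed

lemma prim_fst [prim_intros]: "prim f \<Longrightarrow> prim (\<lambda>x. fst (f x))"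
  by (erule prim_recode[OF _ primrec1.left]) (simp add: code_prod_def)

lemma prim_snd [prim_intros]: "prim f \<Longrightarrow> prim (\<lambda>x. snd (f x))"
  by (erule prim_recode[OF _ primrec1.right]) (simp add: code_prod_def)

lemma prim_Suc [prim_intros]: "prim f \<Longrightarrow> prim (\<lambda>x. Suc (f x))"
  by (erule prim_recode[OF _ primrec1.suc]) simp

lemma prim_code [prim_intros]: "prim f \<Longrightarrow> prim (\<lambda>x. code (f x))"
  by (erule prim_recode[OF _ primrec1.ident]) simp

lemma prim_Some [prim_intros]: "prim f \<Longrightarrow> prim (\<lambda>x. Some (f x))"
  by (erule prim_recode[OF _ primrec1.suc]) simp

lemma prim_prod_decode [prim_intros]: "prim f \<Longrightarrow> prim (\<lambda>x. prod_decode (f x))"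
  by (erule prim_recode[OF _ primrec1.ident]) (simp add: code_prod_def)

lemma prim_list_decode [prim_intros]: "prim f \<Longrightarrow> prim (\<lambda>x. list_decode (f x))"
  by (erule prim_recode[OF _ primrec1.ident]) simp

lemma prim_prod_encode [prim_intros]:
  "prim f \<Longrightarrow> prim (\<lambda>x. prod_encode (f x))" for f :: "'a::coded \<Rightarrow> nat \<times> nat"
  by (erule prim_recode[OF _ primrec1.ident]) (simp add: code_prod_def)

lemma prim_list_encode [prim_intros]: "prim f \<Longrightarrow> prim (\<lambda>x. list_encode (f x))"
  by (erule prim_recode[OF _ primrec1.ident]) simp

lemma prim_Cons [prim_intros]: "prim f \<Longrightarrow> prim g \<Longrightarrow> prim (\<lambda>x. f x # g x)"
  by (erule (1) prim_recode[OF prim_Pair primrec1.suc]) simp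

lemma prim_funpow [prim_intros]:
  fixes f :: "'a::coded \<Rightarrow> 'b::coded \<Rightarrow> 'b"
  assumes "prim (\<lambda>z. f (fst z) (snd z))" "prim a" "prim n"
  shows "prim (\<lambda>x. (f x ^^ n x) (a x))"
proof -
  obtain g where g: "primrec1 g" "\<And>z. g (code z) = code (f (fst z) (snd z))"
    using assms(1) by (metis primE)
  \<comment> \<open>\<open>iter\<close> has no parameters, so the iterated map carries the code of
    \<open>x\<close> along in its left component.\<close>
  let ?h = "\<lambda>m. prod_encode (fst (prod_decode m), g m)"
  have "primrec1 ?h"
    by (intro primrec1.pair primrec1.left g)
  from primrec1.iter[OF this]
  have *: "primrec1 (\<lambda>n. (?h ^^ snd (prod_decode n)) (fst (prod_decode n)))" .
  have "(?h ^^ k) (prod_encode (code x, code y)) = prod_encode (code x, code ((f x ^^ k) y))" for k x y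
    by (induction k) (use g(2)[of "(x, _)"] in simp_all)
  then have "prim (\<lambda>x. (x, (f x ^^ n x) (a x)))"
    by - (rule prim_recode[OF prim_Pair[OF prim_Pair[OF prim_id assms(2)] assms(3)] *], auto)
  from prim_snd[OF this] show ?thesis
    by simp
qed

text \<open>The step may consult its index, so the iteration keeps a counter beside the
  value.\<close>

lemma prim_rec_nat [prim_intros]:
  assumes "prim a" "prim (\<lambda>z. g (fst z) (fst (snd z)) (snd (snd z)))" "prim n"
  shows "prim (\<lambda>x. rec_nat (a x) (g x) (n x))"
proof -
  have "((\<lambda>p. (Suc (fst p), g x (fst p) (snd p))) ^^ k) (0, a x) = (k, rec_nat (a x) (g x) k)" for x k
    by (induction k) auto
  moreover have "prim (\<lambda>x. snd (((\<lambda>p. (Suc (fst p), g x (fst p) (snd p))) ^^ n x) (0, a x)))"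
    by (intro prim_intros assms)
  ultimately show ?thesis
    by simp
qed

lemma prim_case_nat [prim_intros]:
  assumes "prim a" "prim (\<lambda>z. f (fst z) (snd z))" "prim n"
  shows "prim (\<lambda>x. case n x of 0 \<Rightarrow> a x | Suc m \<Rightarrow> f x m)"
proof -
  have "rec_nat (a x) (\<lambda>m _. f x m) k = (case k of 0 \<Rightarrow> a x | Suc m \<Rightarrow> f x m)" for x k
    by (cases k) auto
  moreover have "prim (\<lambda>x. rec_nat (a x) (\<lambda>m _. f x m) (n x))"
    by (intro prim_intros assms prim_comp[OF assms(2), of "\<lambda>z. (fst z, fst (snd z))", simplified])
  ultimately show ?thesis
    by simp
qed

lemma prim_of_bool: "prim P \<Longrightarrow> prim (\<lambda>x. of_bool (P x) :: nat)"
  by (erule prim_recode[OF _ primrec1.ident]) simp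

lemma prim_if [prim_intros]:
  assumes "prim P" "prim f" "prim g"
  shows "prim (\<lambda>x. if P x then f x else g x)"
proof -
  have "prim (\<lambda>x. case of_bool (P x) of 0 \<Rightarrow> g x | Suc m \<Rightarrow> f x)"
    using assms by (intro prim_case_nat prim_of_bool prim_comp[OF assms(2)] prim_intros)
  moreover have "(case of_bool (P x) of 0 \<Rightarrow> g x | Suc m \<Rightarrow> f x) = (if P x then f x else g x)" for x
    by simp
  ultimately show ?thesis
    by simp
qed

lemma prim_Not [prim_intros]: "prim P \<Longrightarrow> prim (\<lambda>x. \<not> P x)"
  using prim_if[OF _ prim_const prim_const, of P False True] by (simp add: if_bool_eq_disj)

lemma prim_conj [prim_intros]: "prim P \<Longrightarrow> prim Q \<Longrightarrow> prim (\<lambda>x. P x \<and> Q x)"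
  using prim_if[OF _ _ prim_const, of P Q False] by (simp add: if_bool_eq_disj)

lemma prim_disj [prim_intros]: "prim P \<Longrightarrow> prim Q \<Longrightarrow> prim (\<lambda>x. P x \<or> Q x)"
  using prim_Not[OF prim_conj[OF prim_Not prim_Not]] by simp

lemma prim_imp [prim_intros]: "prim P \<Longrightarrow> prim Q \<Longrightarrow> prim (\<lambda>x. P x \<longrightarrow> Q x)"
  unfolding imp_conv_disj by (intro prim_disj prim_Not)

lemma prim_add [prim_intros]:
  assumes "prim f" "prim g"
  shows "prim (\<lambda>x. f x + g x :: nat)"
proof -
  have "prim (\<lambda>x. (Suc ^^ f x) (g x))"
    by (intro prim_intros assms)
  moreover have "(Suc ^^ n) m = n + m" for n m
    by (induction n) auto
  ultimately show ?thesis
    by simp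
qed

lemma prim_pred: "prim f \<Longrightarrow> prim (\<lambda>x. f x - 1 :: nat)"
proof -
  assume "prim f"
  then have "prim (\<lambda>x. case f x of 0 \<Rightarrow> 0 | Suc m \<Rightarrow> m)"
    by (intro prim_intros)
  moreover have "(case n of 0 \<Rightarrow> 0 | Suc m \<Rightarrow> m) = n - 1" for n
    by (cases n) auto
  ultimately show ?thesis
    by simp
qed

lemma prim_diff [prim_intros]:
  assumes "prim f" "prim g"
  shows "prim (\<lambda>x. f x - g x :: nat)"
proof -
  have "prim (\<lambda>x. ((\<lambda>m. m - 1) ^^ g x) (f x))"
    by (intro prim_intros prim_pred assms)
  moreover have "((\<lambda>m. m - 1) ^^ n) m = m - n" for n m :: nat
    by (induction n) auto
  ultimately show ?thesis
    by simp
qed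

lemma prim_eq_0: "prim f \<Longrightarrow> prim (\<lambda>x. f x = (0 :: nat))"
proof -
  assume "prim f"
  then have "prim (\<lambda>x. case f x of 0 \<Rightarrow> True | Suc m \<Rightarrow> False)"
    by (intro prim_intros)
  moreover have "(case n of 0 \<Rightarrow> True | Suc m \<Rightarrow> False) = (n = 0)" for n
    by (cases n) auto
  ultimately show ?thesis
    by simp
qed

lemma prim_le [prim_intros]: "prim f \<Longrightarrow> prim g \<Longrightarrow> prim (\<lambda>x. f x \<le> (g x :: nat))"
  using prim_eq_0[OF prim_diff] by simp

lemma prim_less [prim_intros]: "prim f \<Longrightarrow> prim g \<Longrightarrow> prim (\<lambda>x. f x < (g x :: nat))"
  using prim_Not[OF prim_le] by (simp add: not_le)

lemma prim_eq [prim_intros]: "prim f \<Longrightarrow> prim g \<Longrightarrow> prim (\<lambda>x. f x = (g x :: nat))"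
  unfolding eq_iff by (intro prim_intros)

lemma prim_even [prim_intros]:
  assumes "prim f"
  shows "prim (\<lambda>x. even (f x :: nat))"
proof -
  have "prim (\<lambda>x. (Not ^^ f x) True)"
    by (intro prim_intros assms)
  moreover have "(Not ^^ n) True = even n" for n
    by (induction n) auto
  ultimately show ?thesis
    by simp
qed

lemma prim_div_2 [prim_intros]: "prim f \<Longrightarrow> prim (\<lambda>x. f x div 2 :: nat)"
proof -
  have "rec_nat 0 (\<lambda>m r. if even m then r else Suc r) n = n div 2" for n :: nat
    by (induction n) auto
  moreover assume "prim f"
  then have "prim (\<lambda>x. rec_nat 0 (\<lambda>m r. if even m then r else Suc r) (f x))"
    by (intro prim_intros)
  ultimately show ?thesis
    by simp
qed

lemma prim_double [prim_intros]: "prim f \<Longrightarrow> prim (\<lambda>x. 2 * f x :: nat)"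
  using prim_add[of f f] by (simp add: mult_2)

text \<open>The disjunct \<open>n x \<le> i\<close> bounds the search; a failed search returns
  \<open>n x\<close>.\<close>

lemma prim_Least [prim_intros]:
  fixes P :: "'a::coded \<Rightarrow> nat \<Rightarrow> bool"
  assumes "prim (\<lambda>z. P (fst z) (snd z))" "prim n"
  shows "prim (\<lambda>x. LEAST i. P x i \<or> n x \<le> i)"
proof -
  \<comment> \<open>The accumulator equals the index \<open>i\<close> exactly while no witness below
    \<open>i\<close> has been found.\<close>
  have "rec_nat 0 (\<lambda>i r. if r = i \<and> \<not> P x i then Suc i else r) k = (LEAST i. P x i \<or> k \<le> i)" for x k
  proof (induction k)
    case (Suc k)
    define l where "l = (LEAST i. P x i \<or> k \<le> i)"
    have l: "P x l \<or> k \<le> l"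
      unfolding l_def by (rule LeastI[of _ k]) simp
    have min: "l \<le> i" if "P x i \<or> k \<le> i" for i
      unfolding l_def using that by (rule Least_le)
    have "(LEAST i. P x i \<or> Suc k \<le> i) = (if l = k \<and> \<not> P x k then Suc k else l)"
    proof (cases "l = k \<and> \<not> P x k")
      case True
      have "Suc k \<le> i" if "P x i \<or> Suc k \<le> i" for i
        using that True min[of i] by (metis le_neq_implies_less Suc_leI)
      then show ?thesis
        using True by (auto intro: Least_equality)
    next
      case False
      then have "P x l \<or> Suc k \<le> l"
        using l min[of k] by auto
      then have "(LEAST i. P x i \<or> Suc k \<le> i) = l"
        using min by (intro Least_equality) auto
      with False show ?thesis
        by auto
    qed
    then show ?case
      using Suc by (simp add: l_def[symmetric])
  qed simp
  moreover have "prim (\<lambda>x. rec_nat 0 (\<lambda>i r. if r = i \<and> \<not> P x i then Suc i else r) (n x))"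
    by (intro prim_intros assms prim_comp[OF assms(1), of "\<lambda>z. (fst z, fst (snd z))", simplified])
  ultimately show ?thesis
    by simp
qed

lemma prim_ball [prim_intros]:
  fixes P :: "'a::coded \<Rightarrow> nat \<Rightarrow> bool"
  assumes "prim (\<lambda>z. P (fst z) (snd z))" "prim n"
  shows "prim (\<lambda>x. \<forall>i<n x. P x i)"
proof -
  have "(LEAST i. \<not> P x i \<or> k \<le> i) = k \<longleftrightarrow> (\<forall>i<k. P x i)" for x k
  proof
    assume *: "(LEAST i. \<not> P x i \<or> k \<le> i) = k"
    show "\<forall>i<k. P x i"
      using not_less_Least[of _ "\<lambda>i. \<not> P x i \<or> k \<le> i"] unfolding * by blast
  next
    assume "\<forall>i<k. P x i"
    then show "(LEAST i. \<not> P x i \<or> k \<le> i) = k"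
      by (intro Least_equality) (auto simp: not_less[symmetric])
  qed
  moreover have "prim (\<lambda>x. (LEAST i. \<not> P x i \<or> n x \<le> i) = n x)"
    by (intro prim_intros assms)
  ultimately show ?thesis
    by simp
qed

text \<open>On codes this is \<open>case_nat\<close>. The branch for \<open>Some\<close> receives
  only a code as its argument, so \<open>f\<close> has to be replaced there by the function that
  tracks it.\<close>

lemma prim_case_option [prim_intros]:
  assumes "prim a" "prim (\<lambda>z. f (fst z) (snd z))" "prim o'"
  shows "prim (\<lambda>x. case o' x of None \<Rightarrow> a x | Some y \<Rightarrow> f x y)"
proof -
  obtain a' where a: "primrec1 a'" "\<And>x. a' (code x) = code (a x)"
    using primE[OF assms(1)] by blast
  obtain f' where f: "primrec1 f'" "\<And>z. f' (code z) = code (f (fst z) (snd z))"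
    using primE[OF assms(2)] by blast
  obtain o'' where o: "primrec1 o''" "\<And>x. o'' (code x) = code (o' x)"
    using primE[OF assms(3)] by blast
  have pa: "prim a'" and po: "prim o''" and pf: "prim f'"
    using a(1) f(1) o(1) unfolding prim_nat_iff by blast+
  have pf': "prim (\<lambda>z. f' (prod_encode (fst z, snd z)))"
    by (rule prim_comp[OF pf prim_prod_encode[OF prim_Pair[OF prim_fst[OF prim_id] prim_snd[OF prim_id]]]])
  have "primrec1 (\<lambda>n. case o'' n of 0 \<Rightarrow> a' n | Suc m \<Rightarrow> f' (prod_encode (n, m)))"
    using prim_case_nat[OF pa pf' po] unfolding prim_nat_iff .
  moreover have "f' (prod_encode (code x, code y)) = code (f x y)" for x y
    using f(2)[of "(x, y)"] by simp
  ultimately show ?thesis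
    unfolding prim_def using a(2) o(2)
    by (intro exI[of _ "\<lambda>n. case o'' n of 0 \<Rightarrow> a' n | Suc m \<Rightarrow> f' (prod_encode (n, m))"])
      (simp split: option.split)
qed

text \<open>A list has the same code as the option that holds its head and tail, so the identity
  converts one into the other.\<close>

lemma prim_case_list [prim_intros]:
  assumes "prim a" "prim (\<lambda>z. f (fst z) (fst (snd z)) (snd (snd z)))" "prim l"
  shows "prim (\<lambda>x. case l x of [] \<Rightarrow> a x | y # ys \<Rightarrow> f x y ys)"
proof -
  have "prim (\<lambda>x. case l x of [] \<Rightarrow> None | y # ys \<Rightarrow> Some (y, ys))"
    by (rule prim_recode[OF assms(3) primrec1.ident]) (auto split: list.split)
  then have "prim (\<lambda>x. case (case l x of [] \<Rightarrow> None | y # ys \<Rightarrow> Some (y, ys)) of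
      None \<Rightarrow> a x | Some z \<Rightarrow> f x (fst z) (snd z))"
    by (intro prim_intros assms)
  moreover have "(case (case l x of [] \<Rightarrow> None | y # ys \<Rightarrow> Some (y, ys)) of
      None \<Rightarrow> a x | Some z \<Rightarrow> f x (fst z) (snd z)) = (case l x of [] \<Rightarrow> a x | y # ys \<Rightarrow> f x y ys)" for x
    by (simp split: list.split)
  ultimately show ?thesis
    by simp
qed

lemma length_le_code: "length l \<le> code l"
proof (induction l)
  case (Cons x l)
  then show ?case
    using le_prod_encode_2[of "code l" "code x"] by (simp del: code_nat_list)
qed simp

text \<open>Folding iterates a map that pops one element. The code of the list serves as the number
  of rounds, since \<open>length\<close> is itself obtained from folding; surplus rounds meet the
  empty list and change nothing.\<close>

lemma prim_fold [prim_intros]: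
  assumes "prim (\<lambda>z. f (fst z) (fst (snd z)) (snd (snd z)))" "prim l" "prim a"
  shows "prim (\<lambda>x. fold (f x) (l x) (a x))"
proof -
  let ?g = "\<lambda>x p. case fst p of [] \<Rightarrow> p | y # ys \<Rightarrow> (ys, f x y (snd p))"
  have "(?g x ^^ k) (ys, b) = ([], fold (f x) ys b)" if "length ys \<le> k" for x k ys b
    using that
  proof (induction k arbitrary: ys b)
    case (Suc k)
    then show ?case
      by (cases ys) (auto simp: funpow_Suc_right simp del: funpow.simps)
  qed simp
  then have "(?g x ^^ code (l x)) (l x, a x) = ([], fold (f x) (l x) (a x))" for x
    using length_le_code by blast
  moreover have "prim (\<lambda>x. snd ((?g x ^^ code (l x)) (l x, a x)))"
    by (intro prim_intros assms prim_comp[OF assms(1),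
      of "\<lambda>z. (fst (fst z), fst (snd z), snd (snd (fst z)))", simplified])
  ultimately show ?thesis
    by simp
qed

lemma prim_rev [prim_intros]: "prim l \<Longrightarrow> prim (\<lambda>x. rev (l x))"
proof -
  assume "prim l"
  then have "prim (\<lambda>x. fold Cons (l x) [])"
    by (intro prim_intros)
  then show ?thesis
    by (simp add: rev_conv_fold)
qed

lemma prim_foldr [prim_intros]:
  assumes "prim (\<lambda>z. f (fst z) (fst (snd z)) (snd (snd z)))" "prim l" "prim a"
  shows "prim (\<lambda>x. foldr (f x) (l x) (a x))"
  unfolding foldr_conv_fold by (intro prim_intros assms)

lemma prim_append [prim_intros]:
  assumes "prim k" "prim l"
  shows "prim (\<lambda>x. k x @ l x)"
proof -
  have "prim (\<lambda>x. foldr Cons (k x) (l x))"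
    by (intro prim_intros assms)
  moreover have "foldr Cons xs ys = xs @ ys" for xs ys :: "'b list"
    by (induction xs) auto
  ultimately show ?thesis
    by simp
qed

lemma prim_length [prim_intros]:
  assumes "prim l"
  shows "prim (\<lambda>x. length (l x))"
proof -
  have "prim (\<lambda>x. foldr (\<lambda>y. Suc) (l x) 0)"
    by (intro prim_intros assms)
  moreover have "foldr (\<lambda>y. Suc) xs 0 = length xs" for xs :: "'b list"
    by (induction xs) auto
  ultimately show ?thesis
    by simp
qed

lemma prim_tl [prim_intros]:
  assumes "prim l"
  shows "prim (\<lambda>x. tl (l x))"
  unfolding tl_def by (intro prim_intros assms)

lemma prim_drop [prim_intros]:
  assumes "prim n" "prim l"
  shows "prim (\<lambda>x. drop (n x) (l x))"
proof -
  have "prim (\<lambda>x. (tl ^^ n x) (l x))"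
    by (intro prim_intros assms)
  moreover have "(tl ^^ k) xs = drop k xs" for k and xs :: "'b list"
    by (induction k) (auto simp: drop_Suc tl_drop)
  ultimately show ?thesis
    by simp
qed

lemma prim_take [prim_intros]:
  assumes "prim n" "prim l"
  shows "prim (\<lambda>x. take (n x) (l x))"
proof -
  have "prim (\<lambda>x. rev (drop (length (l x) - n x) (rev (l x))))"
    by (intro prim_intros assms)
  moreover have "rev (drop (length xs - k) (rev xs)) = take k xs" for k and xs :: "'b list"
    by (metis rev_rev_ident rev_take)
  ultimately show ?thesis
    by simp
qed

lemma prim_replicate [prim_intros]:
  assumes "prim n" "prim a"
  shows "prim (\<lambda>x. replicate (n x) (a x))"
proof -
  have "prim (\<lambda>x. (Cons (a x) ^^ n x) [])"
    by (intro prim_intros prim_comp[OF assms(2)] assms)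
  moreover have "(Cons b ^^ k) [] = replicate k b" for k and b :: 'b
    by (induction k) auto
  ultimately show ?thesis
    by simp
qed

lemma prim_map_upt [prim_intros]:
  assumes "prim (\<lambda>z. f (fst z) (snd z))" "prim n"
  shows "prim (\<lambda>x. map (f x) [0..<n x])"
proof -
  have "prim (\<lambda>x. rec_nat [] (\<lambda>i l. l @ [f x i]) (n x))"
    by (intro prim_intros prim_comp[OF assms(1), of "\<lambda>z. (fst z, fst (snd z))", simplified] assms)
  moreover have "rec_nat [] (\<lambda>i l. l @ [f x i]) k = map (f x) [0..<k]" for x k
    by (induction k) auto
  ultimately show ?thesis
    by simp
qed

definition lookup :: "'a list \<Rightarrow> nat \<Rightarrow> 'a option" where
  "lookup l i = (if i < length l then Some (l ! i) else None)"

lemma prim_lookup [prim_intros]: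
  assumes "prim l" "prim n"
  shows "prim (\<lambda>x. lookup (l x) (n x))"
proof -
  have "prim (\<lambda>x. case drop (n x) (l x) of [] \<Rightarrow> None | y # ys \<Rightarrow> Some y)"
    by (intro prim_intros assms)
  moreover have "(case drop k xs of [] \<Rightarrow> None | y # ys \<Rightarrow> Some y) = lookup xs k" for k and xs :: "'b list"
    by (auto simp: lookup_def Cons_nth_drop_Suc[symmetric])
  ultimately show ?thesis
    by simp
qed

section \<open>Approximating partial functions on Baire space\<close>

definition initial :: "baire \<Rightarrow> nat \<Rightarrow> nat list" where
  "initial p n = map p [0..<n]"

lemma length_initial [simp]: "length (initial p n) = n"
  by (simp add: initial_def)

lemma lookup_initial: "lookup (initial p n) i = (if i < n then Some (p i) else None)"
  by (simp add: lookup_def initial_def)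

lemma initial_0 [simp]: "initial p 0 = []"
  by (simp add: initial_def)

lemma initial_Suc: "initial p (Suc n) = initial p n @ [p n]"
  by (simp add: initial_def)

lemma nth_initial [simp]: "i < n \<Longrightarrow> initial p n ! i = p i"
  by (simp add: initial_def)

lemma take_initial: "m \<le> n \<Longrightarrow> take m (initial p n) = initial p m"
  by (simp add: initial_def take_map)

text \<open>Here \<open>f e k\<close> is what the finite segment \<open>e\<close> reveals about
  digit \<open>k\<close>. Along \<open>p\<close> an answer is never wrong and is eventually
  permanent. Lists that are not initial segments of \<open>p\<close> are left unconstrained.\<close>

definition approximates :: "(nat list \<Rightarrow> nat \<Rightarrow> nat option) \<Rightarrow> baire \<Rightarrow> baire \<Rightarrow> bool" where
  "approximates f p q \<longleftrightarrow>
    (\<forall>k. (\<forall>n. f (initial p n) k = None \<or> f (initial p n) k = Some (q k)) \<and>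
      (\<exists>m. \<forall>n\<ge>m. f (initial p n) k = Some (q k)))"

lemma approximates_sound:
  "approximates f p q \<Longrightarrow> f (initial p n) k = Some y \<Longrightarrow> y = q k"
  unfolding approximates_def by (metis option.discI option.inject)

lemma approximates_eventually:
  "approximates f p q \<Longrightarrow> \<exists>m. \<forall>n\<ge>m. f (initial p n) k = Some (q k)"
  unfolding approximates_def by blast

lemma prim_implements:
  assumes "prim f"
  obtains P where "\<And>p b s x. (\<And>r. r > b \<Longrightarrow> s r = 0) \<Longrightarrow> s b = code x \<Longrightarrow>
    exec p (P b) s (s(b := code (f x)))"
proof -
  obtain g where g: "primrec1 g" "\<And>x. g (code x) = code (f x)"
    using primE[OF assms] by blast
  obtain P where P: "implements P g"
    using primrec1_implements[OF g(1)] by blast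
  show thesis
    by (rule that[of P]) (use implementsD[OF P] g(2) in metis)
qed

lemma exec_start: "exec p c s t \<Longrightarrow> u = s \<Longrightarrow> exec p c u t"
  by simp

text \<open>The program reads one oracle digit after another until \<open>f\<close> answers on the
  segment read so far. It may stop at the first answer, because answers along \<open>p\<close> are
  never wrong.\<close>

theorem approximates_Phi:
  assumes "prim (\<lambda>z. f (fst z) (snd z))"
  shows "\<exists>n. \<forall>p q. approximates f p q \<longrightarrow> Phi n p = Some q"
proof -
  have "prim (\<lambda>k :: nat. ([] :: nat list, k))"
    by (intro prim_intros)
  then obtain I where I: "\<And>p b s k. (\<And>r. r > b \<Longrightarrow> s r = 0) \<Longrightarrow> s b = code k \<Longrightarrow>
      exec p (I b) s (s(b := code ([] :: nat list, k :: nat)))"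
    using prim_implements by blast
  have "prim (\<lambda>z :: nat list \<times> nat. length (fst z))"
    by (intro prim_intros)
  then obtain N where N: "\<And>p b s z. (\<And>r. r > b \<Longrightarrow> s r = 0) \<Longrightarrow> s b = code z \<Longrightarrow>
      exec p (N b) s (s(b := code (length (fst (z :: nat list \<times> nat)))))"
    using prim_implements by blast
  have "prim (\<lambda>z :: (nat list \<times> nat) \<times> nat. (snd z # fst (fst z), snd (fst z)))"
    by (intro prim_intros)
  then obtain E where E: "\<And>p b s z. (\<And>r. r > b \<Longrightarrow> s r = 0) \<Longrightarrow> s b = code z \<Longrightarrow>
      exec p (E b) s (s(b := code (snd z # fst (fst (z :: (nat list \<times> nat) \<times> nat)), snd (fst z))))"
    using prim_implements by blast
  \<comment> \<open>The segment is stored in reverse, so that a new digit is added by a single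
    \<open>Cons\<close>.\<close>
  have f: "prim (\<lambda>z. f (rev (fst z)) (snd z))"
    using prim_comp[OF assms, of "\<lambda>z. (rev (fst z), snd z)"] by (simp add: prim_intros)
  then have "prim (\<lambda>z. case f (rev (fst z)) (snd z) of None \<Rightarrow> 1 :: nat | Some y \<Rightarrow> 0)"
    by (intro prim_intros)
  then obtain T where T: "\<And>p b s z. (\<And>r. r > b \<Longrightarrow> s r = 0) \<Longrightarrow> s b = code z \<Longrightarrow>
      exec p (T b) s (s(b := code (case f (rev (fst z)) (snd z) of None \<Rightarrow> 1 :: nat | Some y \<Rightarrow> 0)))"
    using prim_implements by blast
  have "prim (\<lambda>z. case f (rev (fst z)) (snd z) of None \<Rightarrow> 0 | Some y \<Rightarrow> y)"
    using f by (intro prim_intros)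
  then obtain Out where Out: "\<And>p b s z. (\<And>r. r > b \<Longrightarrow> s r = 0) \<Longrightarrow> s b = code z \<Longrightarrow>
      exec p (Out b) s (s(b := code (case f (rev (fst z)) (snd z) of None \<Rightarrow> 0 | Some y \<Rightarrow> y)))"
    using prim_implements by blast
  \<comment> \<open>Register \<open>2\<close> holds the code of the reversed segment and
    \<open>k\<close>; register \<open>3\<close> is the loop flag, \<open>1\<close> while
    \<open>f\<close> gives no answer. In \<open>body\<close> the length of the segment is the next
    oracle position: it moves to register \<open>1\<close> for the query, and the reply returns to
    register \<open>3\<close> to be paired with register \<open>2\<close>.\<close>
  define test where "test = Seq (copy_to 2 3 4) (T 3)"
  define body where "body = Seq (clear 3) (Seq (copy_to 2 3 4) (Seq (N 3) (Seq (add_to 3 1)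
    (Seq Ask (Seq (add_to 1 3) (Seq (encode_pair 2) (Seq (E 2) test)))))))"
  define prog where "prog = Seq (add_to 0 2) (Seq (I 2) (Seq test (Seq (While 3 body)
    (Seq (Out 2) (add_to 2 0)))))"
  have outputs: "outputs (compile prog 0) p k (q k)" if "approximates f p q" for p q k
  proof -
    define c where "c n = code (rev (initial p n), k)" for n
    define t where "t n = (case f (initial p n) k of None \<Rightarrow> 1 :: nat | Some y \<Rightarrow> 0)" for n
    define st :: "nat \<Rightarrow> nat \<Rightarrow> nat" where "st n = (\<lambda>_. 0)(2 := c n, 3 := t n)" for n
    define m where "m = (LEAST n. f (initial p n) k \<noteq> None)"
    have m: "f (initial p m) k \<noteq> None"
      unfolding m_def by (rule LeastI_ex) (use approximates_eventually[OF that] in blast)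
    have less: "f (initial p n) k = None" if "n < m" for n
      using not_less_Least that unfolding m_def by blast
    have test: "exec p test ((\<lambda>_. 0)(2 := c n)) (st n)" for n
      unfolding test_def st_def t_def c_def
      by (intro exec.Seq[OF exec_copy_to] exec_eq[OF T[of _ _ "(rev (initial p n), k)"]]) auto
    have body: "exec p body (st n) (st (Suc n))" for n
      unfolding body_def
      by (intro exec.Seq[OF exec_clear] exec.Seq[OF exec_copy_to]
          exec.Seq[OF N[of _ _ "(rev (initial p n), k)"]] exec.Seq[OF exec_add_to]
          exec.Seq[OF exec.Ask] exec.Seq[OF exec_encode_pair]
          exec.Seq[OF E[of _ _ "((rev (initial p n), k), p n)"]] exec_start[OF test])
        (auto simp: st_def c_def initial_Suc fun_eq_iff)
    have "exec p (While 3 body) (st n) (st m)" if "n \<le> m" for n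
      using that
    proof (induction rule: inc_induct)
      case base
      show ?case
        by (rule exec.WhileF) (use m in \<open>auto simp: st_def t_def split: option.split\<close>)
    next
      case (step n)
      show ?case
        by (rule exec.WhileT[OF _ body step.IH]) (use less[OF step.hyps(2)] in \<open>simp add: st_def t_def\<close>)
    qed
    then have loop: "exec p (While 3 body) (st 0) (st m)"
      by simp
    obtain y where y: "f (initial p m) k = Some y"
      using m by blast
    then have qk: "y = q k"
      using approximates_sound[OF that] by blast
    have "exec p prog ((\<lambda>_. 0)(0 := k)) ((\<lambda>_. 0)(0 := q k))"
      unfolding prog_def
      by (intro exec.Seq[OF exec_add_to] exec.Seq[OF I[of _ _ k]]
          exec.Seq[OF exec_start[OF test[of 0]]] exec.Seq[OF loop]
          exec.Seq[OF Out[of _ _ "(rev (initial p m), k)"]] exec_eq[OF exec_add_to])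
        (auto simp: st_def c_def t_def y qk fun_eq_iff)
    then show ?thesis
      using compile_outputs by fastforce
  qed
  obtain n where "machine n = compile prog 0"
    using surj_machine by (metis surjD)
  then show ?thesis
    using outputs by (intro exI[of _ n]) (auto simp: Phi_eq_Some_iff)
qed

section \<open>A universal machine\<close>

type_synonym sim_config = "nat \<times> (nat \<times> nat list \<times> nat list) list"

text \<open>Simulated tapes form an association list in which the leftmost entry wins. A write just
  prepends an entry and shadows the older ones; tapes without an entry are blank.\<close>

definition tape_at :: "(nat \<times> nat list \<times> nat list) list \<Rightarrow> nat \<Rightarrow> tape" where
  "tape_at A t = foldr (\<lambda>z T. if fst z = t then snd z else T) A ([], [])"

lemma tape_at_Cons: "tape_at ((t, T) # A) = (tape_at A)(t := T)"
  by (auto simp: tape_at_def)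

text \<open>Even codes stand for \<open>Scan\<close>, odd ones for \<open>Query\<close>. Being
  unchanged by a simulated step would not do as a criterion, since a query beyond the known part of
  the oracle also stalls; such a configuration is not final.\<close>

definition halted :: "nat list \<Rightarrow> sim_config \<Rightarrow> bool" where
  "halted N c = (case lookup N (fst c) of None \<Rightarrow> True | Some x \<Rightarrow> even x \<and>
    (case lookup (list_decode (snd (prod_decode (x div 2))))
       (head (snd (tape_at (snd c) (fst (prod_decode (x div 2)))))) of None \<Rightarrow> True | Some y \<Rightarrow> False))"

text \<open>A configuration is left unchanged if it is final or if it queries the oracle beyond the
  known part \<open>e\<close>.\<close>

definition sim_step :: "nat list \<Rightarrow> nat list \<Rightarrow> sim_config \<Rightarrow> sim_config" where
  "sim_step N e c = (case lookup N (fst c) of None \<Rightarrow> c | Some x \<Rightarrow>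
    if even x then
      (case lookup (list_decode (snd (prod_decode (x div 2))))
         (head (snd (tape_at (snd c) (fst (prod_decode (x div 2)))))) of
        None \<Rightarrow> c
      | Some y \<Rightarrow>
          (snd (prod_decode (snd (prod_decode y))),
           (fst (prod_decode (x div 2)),
            write_move (fst (prod_decode y)) (move_of (fst (prod_decode (snd (prod_decode y)))))
              (tape_at (snd c) (fst (prod_decode (x div 2))))) # snd c))
    else
      (case lookup e (tape_val (tape_at (snd c) 1)) of
        None \<Rightarrow> c
      | Some v \<Rightarrow> (x div 2, (1, unary v) # snd c)))"

text \<open>The length of \<open>e\<close> doubles as the step bound, so a longer segment provides
  both more oracle and more time.\<close>

definition univ :: "nat \<Rightarrow> nat list \<Rightarrow> nat \<Rightarrow> nat option" where
  "univ n e k =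
    (let c = (sim_step (list_decode n) e ^^ length e) (0, [(0, unary k)])
     in if halted (list_decode n) c then Some (tape_val (tape_at (snd c) 0)) else None)"

lemma prim_tape_at [prim_intros]:
  assumes "prim A" "prim t"
  shows "prim (\<lambda>x. tape_at (A x) (t x))"
  unfolding tape_at_def by (intro prim_intros assms prim_comp[OF assms(2)])

lemma prim_head [prim_intros]:
  assumes "prim l"
  shows "prim (\<lambda>x. head (l x))"
proof -
  have "prim (\<lambda>x. case l x of [] \<Rightarrow> 0 | a # as \<Rightarrow> a)"
    by (intro prim_intros assms)
  moreover have "(case l x of [] \<Rightarrow> 0 | a # as \<Rightarrow> a) = head (l x)" for x
    by (cases "l x") auto
  ultimately show ?thesis
    by simp
qed

lemma prim_unary [prim_intros]: "prim n \<Longrightarrow> prim (\<lambda>x. unary (n x))"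
  unfolding unary_def by (intro prim_intros)

lemma prim_tape_val [prim_intros]:
  assumes "prim T"
  shows "prim (\<lambda>x. tape_val (T x))"
proof -
  have "prim (\<lambda>x. foldr (\<lambda>a n. if a = 1 then Suc n else n) (fst (T x) @ snd (T x)) 0)"
    by (intro prim_intros assms)
  moreover have "foldr (\<lambda>a n. if a = 1 then Suc n else n) l 0 = count_list l 1" for l :: "nat list"
    by (induction l) auto
  ultimately show ?thesis
    by (simp add: tape_val_def del: foldr_append)
qed

lemma prim_write_move [prim_intros]:
  assumes "prim b" "prim m" "prim T"
  shows "prim (\<lambda>x. write_move (b x) (move_of (m x)) (T x))"
proof -
  have "write_move b (move_of m) T =
      (if m = 0 then (tl (fst T), head (fst T) # b # tl (snd T))
       else if m = 1 then (fst T, b # tl (snd T)) else (b # fst T, tl (snd T)))" for b m T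
    by (cases T) (simp add: move_of_def)
  moreover have "prim (\<lambda>x. if m x = 0 then (tl (fst (T x)), head (fst (T x)) # b x # tl (snd (T x)))
       else if m x = 1 then (fst (T x), b x # tl (snd (T x))) else (b x # fst (T x), tl (snd (T x))))"
    by (intro prim_intros assms)
  ultimately show ?thesis
    by simp
qed

lemma prim_halted:
  assumes "prim N" "prim c"
  shows "prim (\<lambda>x. halted (N x) (c x))"
  unfolding halted_def by (intro prim_intros assms prim_comp[OF assms(2)])

lemma prim_sim_step:
  assumes "prim N" "prim e" "prim c"
  shows "prim (\<lambda>x. sim_step (N x) (e x) (c x))"
  unfolding sim_step_def by (intro prim_intros assms prim_comp[OF assms(2)] prim_comp[OF assms(3)])

lemma prim_univ [prim_intros]:
  assumes "prim n" "prim e" "prim k"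
  shows "prim (\<lambda>x. univ (n x) (e x) (k x))"
  unfolding univ_def Let_def
  by (intro prim_intros assms prim_halted prim_sim_step prim_comp[OF assms(1)] prim_comp[OF assms(2)])

section \<open>Correctness of the simulation\<close>

definition config_of :: "sim_config \<Rightarrow> config" where
  "config_of c = (fst c, tape_at (snd c))"

lemma nth_machine: "q < length (list_decode n) \<Longrightarrow> machine n ! q = action_of (list_decode n ! q)"
  and length_machine: "length (machine n) = length (list_decode n)"
  by (simp_all add: machine_def)

lemma action_of_eq:
  "action_of x = (if even x then Scan (fst (prod_decode (x div 2)))
     (map entry_of (list_decode (snd (prod_decode (x div 2))))) else Query (x div 2))"
  by (simp add: action_of_def sum_decode_def split_beta)

lemma entry_of_eq:
  "entry_of y = (fst (prod_decode y), move_of (fst (prod_decode (snd (prod_decode y)))),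
     snd (prod_decode (snd (prod_decode y))))"
  by (simp add: entry_of_def split_beta)

text \<open>Whether a configuration is final depends on the machine alone, so \<open>p\<close> is
  arbitrary.\<close>

lemma halted_iff: "halted (list_decode n) c \<longleftrightarrow> step (machine n) p (config_of c) = None"
  by (auto simp: halted_def config_of_def lookup_def nth_machine length_machine action_of_eq
      entry_of_eq Let_def)

lemma sim_step_sound:
  "sim_step (list_decode n) (initial p m) c = c \<or>
    step (machine n) p (config_of c) = Some (config_of (sim_step (list_decode n) (initial p m) c))"
  by (auto simp: sim_step_def config_of_def lookup_initial[of p] lookup_def[of "list_decode _"]
      nth_machine length_machine action_of_eq entry_of_eq Let_def tape_at_Cons)

lemma sim_step_complete:
  assumes "step (machine n) p (config_of c) = Some c'"
  shows "\<exists>d b. config_of d = c' \<and> (\<forall>m\<ge>b. sim_step (list_decode n) (initial p m) c = d)"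
proof -
  \<comment> \<open>A possible query concerns the number on tape \<open>1\<close>; one digit more
    than that number is enough to answer it.\<close>
  let ?b = "Suc (tape_val (tape_at (snd c) 1))"
  let ?d = "sim_step (list_decode n) (initial p ?b) c"
  have *: "sim_step (list_decode n) (initial p m) c = ?d" if "m \<ge> ?b" for m
    using that by (auto simp: sim_step_def lookup_initial split: option.split)
  moreover have "config_of ?d = c'"
    using assms by (auto simp: sim_step_def config_of_def lookup_initial[of p] lookup_def[of "list_decode _"]
      nth_machine length_machine action_of_eq entry_of_eq Let_def tape_at_Cons split: if_splits)
  ultimately show ?thesis
    by blast
qed

lemma config_of_init: "config_of (0, [(0, unary k)]) = init k"
  by (simp add: config_of_def init_def tape_at_Cons fun_eq_iff) (simp add: tape_at_def)

lemma univ_sound: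
  assumes "univ n (initial p m) k = Some y"
  shows "outputs (machine n) p k y"
proof -
  let ?s = "sim_step (list_decode n) (initial p m)"
  have "moves (machine n) p (config_of c) (config_of ((?s ^^ j) c))" for j c
  proof (induction j)
    case (Suc j)
    then show ?case
      using sim_step_sound[of n p m "(?s ^^ j) c"] by (auto intro: rtranclp.rtrancl_into_rtrancl)
  qed simp
  then have *: "moves (machine n) p (init k) (config_of ((?s ^^ m) (0, [(0, unary k)])))"
    by (metis config_of_init)
  show ?thesis
    unfolding outputs_def
  proof (intro exI conjI, rule *)
    show "step (machine n) p (config_of ((?s ^^ m) (0, [(0, unary k)]))) = None"
      using assms unfolding univ_def Let_def halted_iff[symmetric] by (simp split: if_splits)
    show "tape_val (snd (config_of ((?s ^^ m) (0, [(0, unary k)]))) 0) = y"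
      using assms by (simp add: univ_def Let_def config_of_def split: if_splits)
  qed
qed

lemma univ_complete:
  assumes "outputs (machine n) p k y"
  shows "\<exists>b. \<forall>m\<ge>b. univ n (initial p m) k = Some y"
proof -
  let ?s = "\<lambda>m. sim_step (list_decode n) (initial p m)"
  have *: "\<exists>d b j. config_of d = c' \<and> (\<forall>m\<ge>b. (?s m ^^ j) c = d)"
    if "moves (machine n) p (config_of c) c'" for c c'
    using that
  proof (induction rule: rtranclp_induct)
    case base
    show ?case
      by (intro exI[of _ c] exI[of _ 0]) simp
  next
    case (step c' c'')
    then obtain d b j where d: "config_of d = c'" "\<forall>m\<ge>b. (?s m ^^ j) c = d"
      by blast
    obtain d' b' where d': "config_of d' = c''" "\<forall>m\<ge>b'. ?s m d = d'"
      using sim_step_complete[of n p d c''] step.hyps(2) d(1) by blast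
    have "\<forall>m\<ge>max b b'. (?s m ^^ Suc j) c = d'"
      using d d' by simp
    then show ?case
      using d'(1) by blast
  qed
  obtain c' where c': "moves (machine n) p (config_of (0, [(0, unary k)])) c'"
    "step (machine n) p c' = None" "tape_val (snd c' 0) = y"
    using assms unfolding outputs_def config_of_init by blast
  obtain d b j where d: "config_of d = c'" "\<forall>m\<ge>b. (?s m ^^ j) (0, [(0, unary k)]) = d"
    using *[OF c'(1)] by blast
  have halt: "halted (list_decode n) d"
    using halted_iff d(1) c'(2) by blast
  then have fixed: "?s m d = d" for m
    using sim_step_sound[of n p m d] halted_iff[of n d p] by auto
  \<comment> \<open>\<open>b\<close> guarantees enough oracle and \<open>j\<close> enough steps; all
    further steps stay in the final configuration \<open>d\<close>.\<close>
  have "(?s m ^^ m) (0, [(0, unary k)]) = d" if "m \<ge> max b j" for m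
  proof -
    have "(?s m ^^ i) d = d" for i
      by (induction i) (simp_all add: fixed)
    moreover have "(?s m ^^ m) (0, [(0, unary k)]) = (?s m ^^ (m - j)) ((?s m ^^ j) (0, [(0, unary k)]))"
      using that by (simp flip: funpow_add comp_apply[of "_ ^^ _" "_ ^^ _"])
    ultimately show ?thesis
      using d(2) that by simp
  qed
  then have "\<forall>m\<ge>max b j. univ n (initial p m) k = Some y"
    using halt c'(3) d(1) by (auto simp: univ_def config_of_def)
  then show ?thesis ..
qed

theorem univ_approximates:
  assumes "Phi n p = Some q"
  shows "approximates (univ n) p q"
  unfolding approximates_def
  using assms univ_sound univ_complete outputs_unique
  by (metis Phi_eq_Some_iff option.exhaust)

lemma prim_eq_option [prim_intros]:
  assumes "prim a" "prim b"
  shows "prim (\<lambda>x. a x = (b x :: nat option))"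
proof -
  have "prim (\<lambda>x. code (a x) = code (b x))"
    by (intro prim_intros assms)
  moreover have "code u = code v \<longleftrightarrow> u = v" for u v :: "nat option"
    by (cases u; cases v) auto
  ultimately show ?thesis
    by simp
qed

lemma prim_eq_list [prim_intros]:
  assumes "prim a" "prim b"
  shows "prim (\<lambda>x. a x = (b x :: nat list))"
proof -
  have "prim (\<lambda>x. code (a x) = code (b x))"
    by (intro prim_intros assms)
  then show ?thesis
    by (simp add: list_encode_eq)
qed

text \<open>The digits before the first one that \<open>f\<close> leaves open on the segment \<open>e\<close>.\<close>

definition prefix_of :: "(nat list \<Rightarrow> nat \<Rightarrow> nat option) \<Rightarrow> nat list \<Rightarrow> nat list" where
  "prefix_of f e = map (\<lambda>i. case f e i of None \<Rightarrow> 0 | Some y \<Rightarrow> y)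
    [0..<(LEAST i. f e i = None \<or> length e \<le> i)]"

lemma prim_prefix_of [prim_intros]:
  assumes f: "prim (\<lambda>z. f (fst z) (fst (snd z)) (snd (snd z)))" and e: "prim e"
  shows "prim (\<lambda>x. prefix_of (f x) (e x))"
proof -
  have "prim (\<lambda>z. f (fst z) (e (fst z)) (snd z))"
    using prim_comp[OF f, of "\<lambda>z. (fst z, e (fst z), snd z)"]
    by (simp add: prim_intros prim_comp[OF e])
  then show ?thesis
    unfolding prefix_of_def by (intro prim_intros e)
qed

text \<open>Answers along \<open>p\<close> are right, so the collected digits form a genuine segment
  of \<open>q\<close>. Composition depends on this, as \<open>approximates\<close> says nothing
  about other lists.\<close>

lemma prefix_of_initial:
  assumes "approximates f p q"
  shows "prefix_of f (initial p n) = initial q (LEAST i. f (initial p n) i = None \<or> n \<le> i)"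
proof -
  define l where "l = (LEAST i. f (initial p n) i = None \<or> n \<le> i)"
  have "f (initial p n) i = Some (q i)" if "i < l" for i
  proof -
    have "f (initial p n) i \<noteq> None"
      using not_less_Least[OF that[unfolded l_def]] by simp
    then show ?thesis
      using approximates_sound[OF assms] by fastforce
  qed
  then show ?thesis
    by (simp add: prefix_of_def initial_def[of q] flip: l_def)
qed

lemma approximates_eventually_all:
  assumes "approximates f p q"
  shows "\<exists>m. \<forall>n\<ge>m. \<forall>i<k. f (initial p n) i = Some (q i)"
proof (induction k)
  case (Suc k)
  then obtain m where m: "\<forall>n\<ge>m. \<forall>i<k. f (initial p n) i = Some (q i)" ..
  obtain m' where m': "\<forall>n\<ge>m'. f (initial p n) k = Some (q k)"
    using approximates_eventually[OF assms] by blast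
  show ?case
    using m m' by (intro exI[of _ "max m m'"]) (auto simp: less_Suc_eq)
qed simp

lemma prefix_of_eventually:
  assumes "approximates f p q"
  shows "\<exists>m. \<forall>n\<ge>m. \<exists>l\<ge>k. prefix_of f (initial p n) = initial q l"
proof -
  obtain m where m: "\<forall>n\<ge>m. \<forall>i<k. f (initial p n) i = Some (q i)"
    using approximates_eventually_all[OF assms] by blast
  have "k \<le> (LEAST i. f (initial p n) i = None \<or> n \<le> i)" if n: "n \<ge> max m k" for n
  proof (rule LeastI2[of _ n])
    fix i assume "f (initial p n) i = None \<or> n \<le> i"
    then show "k \<le> i"
      using m n by (metis max.bounded_iff not_le option.discI order_trans)
  qed simp
  then show ?thesis
    using prefix_of_initial[OF assms] by (intro exI[of _ "max m k"]) auto
qed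

lemma approximates_comp:
  assumes "approximates f p q" "approximates g q r"
  shows "approximates (\<lambda>e. g (prefix_of f e)) p r"
  unfolding approximates_def
proof (intro allI conjI)
  fix k n
  show "g (prefix_of f (initial p n)) k = None \<or> g (prefix_of f (initial p n)) k = Some (r k)"
    using assms(2) unfolding prefix_of_initial[OF assms(1)] approximates_def by blast
next
  fix k
  obtain m where m: "\<forall>n\<ge>m. g (initial q n) k = Some (r k)"
    using approximates_eventually[OF assms(2)] by blast
  show "\<exists>m. \<forall>n\<ge>m. g (prefix_of f (initial p n)) k = Some (r k)"
    using prefix_of_eventually[OF assms(1), of m] m by metis
qed

lemma approximates_lookup: "approximates (\<lambda>e k. lookup e (g k)) p (\<lambda>k. p (g k))"
proof -
  have "\<forall>n\<ge>Suc (g k). lookup (initial p n) (g k) = Some (p (g k))" for k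
    by (simp add: lookup_initial)
  then show ?thesis
    unfolding approximates_def by (metis lookup_initial)
qed

lemma approximates_bfst: "approximates (\<lambda>e k. lookup e (2 * k)) (bpair p q) p"
  using approximates_lookup[of "\<lambda>k. 2 * k" "bpair p q"] by (simp add: bpair_def)

lemma approximates_bsnd: "approximates (\<lambda>e k. lookup e (Suc (2 * k))) (bpair p q) q"
  using approximates_lookup[of "\<lambda>k. Suc (2 * k)" "bpair p q"] by (simp add: bpair_def)

lemma approximates_bpair:
  assumes "approximates f p q" "approximates g p r"
  shows "approximates (\<lambda>e k. if even k then f e (k div 2) else g e (k div 2)) p (bpair q r)"
  using assms unfolding approximates_def bpair_def by simp

text \<open>Meant for a machine index that must itself be read off the oracle: \<open>N\<close>
  delivers the index, \<open>f\<close> runs the machine.\<close>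

lemma approximates_case:
  assumes "approximates (\<lambda>e _. N e) p (\<lambda>_. n)" "approximates (f n) p q"
  shows "approximates (\<lambda>e k. case N e of None \<Rightarrow> None | Some m \<Rightarrow> f m e k) p q"
  unfolding approximates_def
proof (intro allI conjI)
  fix k j
  show "(case N (initial p j) of None \<Rightarrow> None | Some m \<Rightarrow> f m (initial p j) k) = None \<or>
    (case N (initial p j) of None \<Rightarrow> None | Some m \<Rightarrow> f m (initial p j) k) = Some (q k)"
  proof (cases "N (initial p j)")
    case (Some m)
    then have "m = n"
      using approximates_sound[OF assms(1)] by blast
    then show ?thesis
      using Some assms(2) by (simp add: approximates_def)
  qed simp
next
  fix k
  obtain m where m: "\<forall>j\<ge>m. N (initial p j) = Some n"
    using approximates_eventually[OF assms(1)] by blast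
  obtain m' where m': "\<forall>j\<ge>m'. f n (initial p j) k = Some (q k)"
    using approximates_eventually[OF assms(2)] by blast
  show "\<exists>m. \<forall>j\<ge>m. (case N (initial p j) of None \<Rightarrow> None | Some m \<Rightarrow> f m (initial p j) k) = Some (q k)"
    using m m' by (intro exI[of _ "max m m'"]) simp
qed

section \<open>Names of functions and their evaluation\<close>

definition fname_digit :: "nat \<Rightarrow> nat list \<Rightarrow> nat \<Rightarrow> nat option" where
  "fname_digit n e k = (if k < n then Some 0 else if k = n then Some 1 else lookup e (k - Suc n))"

lemma prim_fname_digit [prim_intros]:
  "prim e \<Longrightarrow> prim k \<Longrightarrow> prim (\<lambda>x. fname_digit n (e x) (k x))"
  unfolding fname_digit_def by (intro prim_intros)

lemma approximates_fname: "approximates (fname_digit n) p (fname n p)"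
  using approximates_lookup[of "\<lambda>k. k - Suc n" p]
  unfolding approximates_def fname_digit_def fname_def by auto

definition name_index :: "nat list \<Rightarrow> nat option" where
  "name_index e = (let i = LEAST i. lookup e i = Some 1 \<or> length e \<le> i
    in if lookup e i = Some 1 then Some i else None)"

lemma name_index_initial:
  "name_index (initial (fname n p) m) = (if n < m then Some n else None)"
proof (cases "n < m")
  case True
  then have "(LEAST i. lookup (initial (fname n p) m) i = Some 1 \<or> m \<le> i) = n"
    by (intro Least_equality) (auto simp: lookup_initial fname_def split: if_splits)
  then show ?thesis
    using True by (simp add: name_index_def lookup_initial fname_def)
next
  case False
  then show ?thesis
    by (auto simp: name_index_def Let_def lookup_initial fname_def)
qed

lemma approximates_name_index: "approximates (\<lambda>e _. name_index e) (fname n p) (\<lambda>_. n)"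
  unfolding approximates_def name_index_initial by (auto intro: exI[of _ "Suc n"])

text \<open>Rebuilds the oracle that machine \<open>n\<close> expects. From
  \<open>bpair (fname n p) s\<close> the even digits recover \<open>p\<close> by skipping the header
  of length \<open>Suc n\<close>, and the odd digits are those of the translation of
  \<open>s\<close> by machine \<open>h\<close>.\<close>

definition translated :: "nat \<Rightarrow> nat \<Rightarrow> nat list \<Rightarrow> nat \<Rightarrow> nat option" where
  "translated h n e k =
    (if even k then lookup (prefix_of (\<lambda>e k. lookup e (2 * k)) e) (Suc (n + k div 2))
     else univ h (prefix_of (\<lambda>e k. lookup e (Suc (2 * k))) e) (k div 2))"

text \<open>If \<open>t\<close> names \<open>f\<close> and the machine \<open>h\<close> translates \<open>s\<close> into a name
  of \<open>x\<close>, then \<open>applied h\<close> approximates a name of \<open>f x\<close> on the oracle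
  \<open>bpair t s\<close>.\<close>

definition applied :: "nat \<Rightarrow> nat list \<Rightarrow> nat \<Rightarrow> nat option" where
  "applied h e k = (case name_index (prefix_of (\<lambda>e k. lookup e (2 * k)) e) of
     None \<Rightarrow> None | Some n \<Rightarrow> univ n (prefix_of (translated h n) e) k)"

lemma prim_name_index [prim_intros]:
  assumes "prim e"
  shows "prim (\<lambda>x. name_index (e x))"
  unfolding name_index_def Let_def by (intro prim_intros assms prim_comp[OF assms])

lemma prim_translated [prim_intros]:
  assumes "prim n" "prim e" "prim k"
  shows "prim (\<lambda>x. translated h (n x) (e x) (k x))"
  unfolding translated_def by (intro prim_intros assms)

lemma prim_applied [prim_intros]:
  assumes "prim e" "prim k"
  shows "prim (\<lambda>x. applied h (e x) (k x))"
  unfolding applied_def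
  by (intro prim_intros assms prim_comp[OF assms(1)] prim_comp[OF assms(2)])

lemma approximates_applied:
  assumes "Phi h s = Some r" "Phi n (bpair p r) = Some z"
  shows "approximates (applied h) (bpair (fname n p) s) z"
proof -
  note left = approximates_bfst[of "fname n p" s]
  have "approximates (\<lambda>e k. lookup e (Suc (n + k))) (fname n p) p"
    using approximates_lookup[of "\<lambda>k. Suc (n + k)" "fname n p"] by (simp add: fname_def)
  from approximates_bpair[OF approximates_comp[OF left this]
      approximates_comp[OF approximates_bsnd univ_approximates[OF assms(1)]]]
  have "approximates (translated h n) (bpair (fname n p) s) (bpair p r)"
    by (simp add: translated_def[abs_def])
  then have "approximates (\<lambda>e. univ n (prefix_of (translated h n) e)) (bpair (fname n p) s) z"
    by (rule approximates_comp) (rule univ_approximates[OF assms(2)])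
  from approximates_case[where f = "\<lambda>n e. univ n (prefix_of (translated h n) e)",
      OF approximates_comp[OF left approximates_name_index] this]
  show ?thesis
    by (simp add: applied_def[abs_def])
qed

section \<open>Names of ranks\<close>

lemma fst_prod_decode_le: "fst (prod_decode n) \<le> n"
  by (metis le_prod_encode_1 prod.collapse prod_decode_inverse)

lemma snd_prod_decode_le: "snd (prod_decode n) \<le> n"
  by (metis le_prod_encode_2 prod.collapse prod_decode_inverse)

lemma length_list_decode_le: "length (list_decode n) \<le> n"
  using length_le_code[of "list_decode n"] by simp

text \<open>The sequence \<open>rank_name R v\<close> names the supremum of the successors of the
  ordinals named by \<open>rank_name R w\<close> for \<open>R v w\<close>.\<close>

function rank_name :: "(nat \<Rightarrow> nat \<Rightarrow> bool) \<Rightarrow> nat \<Rightarrow> nat \<Rightarrow> nat" where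
  "rank_name R v 0 = 2"
| "rank_name R v (Suc j) =
    (if R v (fst (prod_decode j))
     then (case snd (prod_decode j) of 0 \<Rightarrow> 1 | Suc i \<Rightarrow> rank_name R (fst (prod_decode j)) i)
     else 0)"
  by pat_completeness auto
text \<open>The recursion descends on the digit position and not along \<open>R\<close>. The digits
  are thus defined and computable for any relation; well-foundedness enters only in showing that
  they name an ordinal.\<close>

termination
proof (relation "measure (\<lambda>(R, v, j). j)", simp, clarsimp)
  show "snd (prod_decode j) = Suc i \<Longrightarrow> i < Suc j" for i j
    using snd_prod_decode_le[of j] by simp
qed

lemma rank_name_eq:
  "rank_name R v = bcons 2 (btuple (\<lambda>w. if R v w then bcons 1 (rank_name R w) else bcons 0 (\<lambda>_. 0)))"
proof
  fix j
  show "rank_name R v j =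
    bcons 2 (btuple (\<lambda>w. if R v w then bcons 1 (rank_name R w) else bcons 0 (\<lambda>_. 0))) j"
    by (cases j) (auto simp: bcons_def btuple_def split: nat.split prod.split)
qed

definition rank :: "(nat \<Rightarrow> nat \<Rightarrow> bool) \<Rightarrow> nat \<Rightarrow> cord" where
  "rank R v = (THE a. nK (rank_name R v) a)"

lemma nK_rank_name:
  assumes "\<And>w. R v w \<Longrightarrow> nK (rank_name R w) (a w)"
  shows "nK (rank_name R v) (ord_sup (\<lambda>w. if R v w then ord_succ (a w) else ord_zero))"
  unfolding rank_name_eq[of R v] 
  by (intro nK.sup) (auto intro: nK.zero nK.succ[unfolded One_nat_def] assms)

lemma nK_rank:
  assumes "wf {(w, v). R v w}"
  shows "nK (rank_name R v) (rank R v)"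
proof -
  have "\<exists>a. nK (rank_name R v) a"
    using assms
  proof (induction v rule: wf_induct_rule)
    case (less v)
    then obtain a where "\<And>w. R v w \<Longrightarrow> nK (rank_name R w) (a w)"
      by (metis case_prodI mem_Collect_eq)
    then show ?case
      using nK_rank_name by blast
  qed
  then show ?thesis
    unfolding rank_def using nK_unique by (blast intro: theI2)
qed

lemma rank_less:
  assumes "wf {(w, v). R v w}" "R v w"
  shows "rank R w < rank R v"
proof -
  have "rank R v = ord_sup (\<lambda>w. if R v w then ord_succ (rank R w) else ord_zero)"
    by (rule nK_unique[OF nK_rank nK_rank_name]) (use assms nK_rank in auto)
  then have "ord_succ (rank R w) \<le> rank R v"
    using le_ord_sup[of "\<lambda>w. if R v w then ord_succ (rank R w) else ord_zero" w] assms(2) by simp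
  then show ?thesis
    by (simp add: ord_succ_le_iff)
qed

text \<open>Both components of a decoded pair are bounded by its code, so digit \<open>j\<close>
  consults the relation only at second arguments below \<open>j\<close>. Hence a finite part of the
  oracle determines it.\<close>

lemma rank_name_cong:
  assumes "\<And>v w. w < j \<Longrightarrow> R v w \<longleftrightarrow> R' v w"
  shows "rank_name R v j = rank_name R' v j"
  using assms
proof (induction R v j rule: rank_name.induct)
  case (2 R v j)
  have *: "fst (prod_decode j) < Suc j"
    using fst_prod_decode_le[of j] by simp
  show ?case
  proof (cases "R v (fst (prod_decode j)) \<and> snd (prod_decode j) \<noteq> 0")
    case True
    then obtain i where i: "snd (prod_decode j) = Suc i"
      by (auto simp: gr0_conv_Suc)
    then have "i < j"
      using snd_prod_decode_le[of j] by simp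
    then have "rank_name R (fst (prod_decode j)) i = rank_name R' (fst (prod_decode j)) i"
      using 2 i True by simp
    then show ?thesis
      using True i 2(2)[OF *] by simp
  next
    case False
    then show ?thesis
      using 2(2)[OF *, of v] by auto
  qed
qed simp

text \<open>\<open>rank_name\<close> is tail recursive, so it can be evaluated by iterating a map on
  triples of node, position and result. The position strictly decreases, hence \<open>Suc j\<close>
  rounds suffice for digit \<open>j\<close>.\<close>

definition rank_name_step ::
  "(nat \<Rightarrow> nat \<Rightarrow> bool) \<Rightarrow> nat \<times> nat \<times> nat option \<Rightarrow> nat \<times> nat \<times> nat option" where
  "rank_name_step R z = (case snd (snd z) of Some y \<Rightarrow> z | None \<Rightarrow>
    (case fst (snd z) of 0 \<Rightarrow> (0, 0, Some 2) | Suc j \<Rightarrow>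
      if R (fst z) (fst (prod_decode j))
      then (case snd (prod_decode j) of 0 \<Rightarrow> (0, 0, Some 1) | Suc i \<Rightarrow> (fst (prod_decode j), i, None))
      else (0, 0, Some 0)))"

lemma funpow_rank_name_step:
  "j < n \<Longrightarrow> snd (snd ((rank_name_step R ^^ n) (v, j, None))) = Some (rank_name R v j)"
proof (induction R v j arbitrary: n rule: rank_name.induct)
  case (1 R v)
  have "(rank_name_step R ^^ n) (0, 0, Some y) = (0, 0, Some y)" for n y
    by (induction n) (auto simp: rank_name_step_def)
  moreover obtain m where "n = Suc m"
    using 1 by (cases n) auto
  ultimately show ?case
    by (simp add: funpow_Suc_right rank_name_step_def[of R "(v, _)"] del: funpow.simps)
next
  case (2 R v j)
  have *: "(rank_name_step R ^^ n) (0, 0, Some y) = (0, 0, Some y)" for n y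
    by (induction n) (auto simp: rank_name_step_def)
  obtain m where n: "n = Suc m"
    using 2 by (cases n) auto
  show ?case
  proof (cases "R v (fst (prod_decode j)) \<and> snd (prod_decode j) \<noteq> 0")
    case True
    then obtain i where i: "snd (prod_decode j) = Suc i"
      by (auto simp: gr0_conv_Suc)
    then have "i < m"
      using snd_prod_decode_le[of j] 2 n by simp
    then show ?thesis
      using 2(1)[of i m] True i
      by (simp add: n funpow_Suc_right rank_name_step_def[of R "(v, _)"] del: funpow.simps)
  next
    case False
    then show ?thesis
      by (auto simp: n funpow_Suc_right rank_name_step_def[of R "(v, _)"] * simp del: funpow.simps)
  qed
qed

lemma prim_rank_name [prim_intros]:
  assumes R: "prim (\<lambda>z. R (fst z) (fst (snd z)) (snd (snd z)))" and v: "prim v" and j: "prim j"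
  shows "prim (\<lambda>x. rank_name (R x) (v x) (j x))"
proof -
  have *: "prim (\<lambda>y. R (fst (fst y)) (fst (snd (fst y))) (fst (prod_decode (snd y))))" 
    using prim_comp[OF R, of "\<lambda>y. (fst (fst y), fst (snd (fst y)), fst (prod_decode (snd y)))"]
    by (simp add: prim_intros)
  have "prim (\<lambda>y. rank_name_step (R (fst y)) (snd y))"
    unfolding rank_name_step_def by (intro prim_intros *)
  then have "prim (\<lambda>x. case snd (snd ((rank_name_step (R x) ^^ Suc (j x)) (v x, j x, None)))
      of None \<Rightarrow> 0 | Some y \<Rightarrow> y)"
    by (intro prim_intros v j)
  then show ?thesis
    by (simp add: funpow_rank_name_step del: funpow.simps)
qed

section \<open>The tree of mind changes\<close>

text \<open>A node codes a position \<open>k\<close> and an initial segment \<open>e\<close> of an oracle.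
  A child of a node extends it and determines another digit \<open>0\<close>. The even digits of the
  oracle are prescribed by \<open>c\<close>.\<close>

abbreviation node_pos :: "nat \<Rightarrow> nat" where
  "node_pos v \<equiv> fst (prod_decode v)"

abbreviation node_seg :: "nat \<Rightarrow> nat list" where
  "node_seg v \<equiv> list_decode (snd (prod_decode v))"

definition child :: "(nat list \<Rightarrow> nat \<Rightarrow> nat option) \<Rightarrow> (nat \<Rightarrow> nat option) \<Rightarrow> nat \<Rightarrow> nat \<Rightarrow> bool" where
  "child f c v w \<longleftrightarrow> node_pos v < node_pos w \<and>
    take (length (node_seg v)) (node_seg w) = node_seg v \<and>
    f (node_seg w) (node_pos w) = Some 0 \<and>
    (\<forall>i<length (node_seg w). even i \<longrightarrow> lookup (node_seg w) i = c i)"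

text \<open>For even \<open>i\<close>, \<open>t (i div 2)\<close> is digit \<open>i\<close> of
  \<open>bpair t s\<close> for every \<open>s\<close>. This is the relation with all of
  \<open>t\<close> known; \<open>rank_digit\<close> works with \<open>child f (lookup e)\<close>,
  which sees a finite part.\<close>

abbreviation mind_changes :: "(nat list \<Rightarrow> nat \<Rightarrow> nat option) \<Rightarrow> baire \<Rightarrow> nat \<Rightarrow> nat \<Rightarrow> bool" where
  "mind_changes f t \<equiv> child f (\<lambda>i. Some (t (i div 2)))"

lemma wf_mind_changes:
  assumes total: "\<And>s. \<exists>z. approximates f (bpair t s) z \<and> finite {k. z k = 0}"
  shows "wf {(w, v). mind_changes f t v w}"
  unfolding wf_iff_no_infinite_down_chain
proof
  assume "\<exists>v. \<forall>i. (v (Suc i), v i) \<in> {(w, v). mind_changes f t v w}"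
  then obtain v where v: "\<And>i. mind_changes f t (v i) (v (Suc i))"
    by blast
  \<comment> \<open>The shift by one drops the start of the chain, which is nobody's child and hence
    need not agree with \<open>t\<close>.\<close>
  define e where "e i = node_seg (v (Suc i))" for i
  have step: "take (length (e i)) (e (Suc i)) = e i" for i
    using v[of "Suc i"] by (simp add: child_def e_def)
  have prefix: "i \<le> j \<Longrightarrow> take (length (e i)) (e j) = e i" for i j
  proof (induction j rule: dec_induct)
    case (step j)
    then have "length (e i) \<le> length (e j)"
      by (metis length_take min.cobounded1 min.commute)
    then show ?case
      using \<open>\<And>i. take (length (e i)) (e (Suc i)) = e i\<close>[of j] step.IH
      by (metis min.absorb1 take_take)
  qed simp
  have agree: "e i ! k = e j ! k" if "k < length (e i)" "k < length (e j)" for i j k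
    using prefix[of i j] prefix[of j i] that by (metis nle_le nth_take)
  \<comment> \<open>The segments need not grow, so they may leave some digits of \<open>s\<close>
    open. \<open>SOME\<close> then fills these in arbitrarily, which is harmless because
    \<open>total\<close> covers every \<open>s\<close>.\<close>
  define s where "s k = e (SOME i. Suc (2 * k) < length (e i)) ! Suc (2 * k)" for k
  have "e i ! k = bpair t s k" if k: "k < length (e i)" for i k
  proof (cases "even k")
    case True
    then show ?thesis
      using v[of i] k by (auto simp: child_def e_def bpair_def lookup_def)
  next
    case False
    then obtain j where j: "k = Suc (2 * j)"
      by (auto elim: oddE)
    then have "Suc (2 * j) < length (e (SOME i. Suc (2 * j) < length (e i)))"
      using k by (metis (mono_tags, lifting) someI_ex)
    then have "e i ! k = s j"
      using agree k unfolding s_def j by blast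
    then show ?thesis
      by (simp add: j bpair_def)
  qed
  then have e: "e i = initial (bpair t s) (length (e i))" for i
    by (intro nth_equalityI) simp_all
  obtain z where z: "approximates f (bpair t s) z" "finite {k. z k = 0}"
    using total by blast
  have "z (node_pos (v (Suc i))) = 0" for i
    using v[of i] approximates_sound[OF z(1)] e[of i] unfolding child_def e_def by metis
  then have "range (\<lambda>i. node_pos (v (Suc i))) \<subseteq> {k. z k = 0}"
    by (auto simp del: split_paired_All)
  moreover have "strict_mono (\<lambda>i. node_pos (v (Suc i)))"
    using v unfolding strict_mono_Suc_iff child_def by blast
  ultimately show False
    using z(2) by (meson finite_subset range_inj_infinite strict_mono_imp_inj_on)
qed

lemma prim_child [prim_intros]:
  assumes f: "prim (\<lambda>z. f (fst z) (snd z))" and c: "prim (\<lambda>z. c (fst z) (snd z))"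
    and v: "prim v" and w: "prim w"
  shows "prim (\<lambda>x. child f (c x) (v x) (w x))"
  unfolding child_def
  by (intro prim_intros v w prim_comp[OF w] c
    prim_comp[OF f, of "\<lambda>x. (node_seg (w x), node_pos (w x))", simplified])

text \<open>Position \<open>1\<close> of \<open>bpair t r\<close> holds \<open>r 0\<close>, the
  index of the ordinal asked for. Length \<open>j + 2\<close> reaches this position and covers the
  segments of all nodes below \<open>j\<close>, since a list is no longer than its code.\<close>

definition rank_digit :: "(nat list \<Rightarrow> nat \<Rightarrow> nat option) \<Rightarrow> nat list \<Rightarrow> nat \<Rightarrow> nat option" where
  "rank_digit f e j = (if length e < j + 2 then None else
     case lookup e 1 of None \<Rightarrow> None | Some v \<Rightarrow> Some (rank_name (child f (lookup e)) v j))"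

lemma prim_rank_digit [prim_intros]:
  assumes "prim (\<lambda>z. f (fst z) (snd z))" "prim e" "prim j"
  shows "prim (\<lambda>x. rank_digit f (e x) (j x))"
  unfolding rank_digit_def
  by (intro prim_intros assms prim_comp[OF assms(2)] prim_comp[OF assms(3)])

lemma approximates_rank_digit:
  "approximates (rank_digit f) (bpair t r) (rank_name (mind_changes f t) (r 0))"
proof -
  have "rank_digit f (initial (bpair t r) n) j = Some (rank_name (mind_changes f t) (r 0) j)"
    if n: "j + 2 \<le> n" for n j
  proof -
    have "rank_name (child f (lookup (initial (bpair t r) n))) (r 0) j =
      rank_name (mind_changes f t) (r 0) j"
    proof (rule rank_name_cong)
      fix v w assume "w < j"
      have "length (node_seg w) < n"
        using length_list_decode_le[of "snd (prod_decode w)"] snd_prod_decode_le[of w] \<open>w < j\<close> n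
        by simp
      then have "lookup (initial (bpair t r) n) i = Some (t (i div 2))"
        if "i < length (node_seg w)" "even i" for i
        using that by (simp add: lookup_initial bpair_def)
      then show "child f (lookup (initial (bpair t r) n)) v w \<longleftrightarrow> mind_changes f t v w"
        unfolding child_def by metis
    qed
    then show ?thesis
      using n by (simp add: rank_digit_def lookup_initial bpair_def)
  qed
  moreover have "rank_digit f (initial (bpair t r) n) j = None" if "n < j + 2" for n j
    using that by (simp add: rank_digit_def)
  ultimately show ?thesis
    unfolding approximates_def by (metis not_le)
qed

text \<open>Asking for all digits up to \<open>k\<close>, and not just for the \<open>k\<close>-th, makes the
  segments grow with \<open>k\<close>.\<close>

definition defined_upto :: "(nat list \<Rightarrow> nat \<Rightarrow> nat option) \<Rightarrow> nat \<Rightarrow> nat list \<Rightarrow> bool" where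
  "defined_upto f k e \<longleftrightarrow> (\<forall>i<Suc k. f e i \<noteq> None)"

definition modulus :: "(nat list \<Rightarrow> nat \<Rightarrow> nat option) \<Rightarrow> baire \<Rightarrow> nat \<Rightarrow> nat" where
  "modulus f p k = (LEAST l. defined_upto f k (initial p l))"

text \<open>\<open>Lmap\<close> reads the odd digit \<open>2 * i + 1\<close> as a reference to
  ordinal \<open>i\<close>, here a node code, and halves the digits after the last odd one.
  \<open>Delta\<close> decrements after the last zero, so a nonzero \<open>y\<close> becomes
  \<open>2 * (y - 1)\<close>.\<close>

definition marked_digit :: "nat \<Rightarrow> nat list \<Rightarrow> nat \<Rightarrow> nat" where
  "marked_digit k e y = (if y = 0 then Suc (2 * prod_encode (k, list_encode e)) else 2 * (y - 1))"

text \<open>The mark contains a segment, so it would change with the amount of oracle read. Cutting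
  \<open>e\<close> down to its shortest sufficient part makes the digit well defined. If no part
  suffices, \<open>d\<close> is \<open>e\<close> itself and the test fails.\<close>

definition marked :: "(nat list \<Rightarrow> nat \<Rightarrow> nat option) \<Rightarrow> nat list \<Rightarrow> nat \<Rightarrow> nat option" where
  "marked f e k =
    (let d = take (LEAST l. defined_upto f k (take l e) \<or> length e \<le> l) e
     in if defined_upto f k d
       then (case f d k of None \<Rightarrow> None | Some y \<Rightarrow> Some (marked_digit k d y)) else None)"

lemma prim_defined_upto:
  assumes f: "prim (\<lambda>z. f (fst z) (snd z))" and "prim k" "prim e"
  shows "prim (\<lambda>x. defined_upto f (k x) (e x))"
  unfolding defined_upto_def
  by (intro prim_intros assms
    prim_comp[OF f, of "\<lambda>x. (e (fst x), snd x)", simplified] prim_comp[OF assms(3)])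

lemma prim_marked_digit:
  assumes "prim k" "prim e" "prim y"
  shows "prim (\<lambda>x. marked_digit (k x) (e x) (y x))"
  unfolding marked_digit_def by (intro prim_intros assms)

lemma prim_marked [prim_intros]:
  assumes f: "prim (\<lambda>z. f (fst z) (snd z))" and e: "prim e" and k: "prim k"
  shows "prim (\<lambda>x. marked f (e x) (k x))"
proof -
  have d: "prim (\<lambda>x. take (LEAST l. defined_upto f (k x) (take l (e x)) \<or> length (e x) \<le> l) (e x))"
    by (intro prim_intros prim_defined_upto f e k prim_comp[OF e] prim_comp[OF k])
  have "prim (\<lambda>x. f (take (LEAST l. defined_upto f (k x) (take l (e x)) \<or> length (e x) \<le> l) (e x)) (k x))"
    using prim_comp[OF f prim_Pair[OF d k]] by simp
  with d show ?thesis
    unfolding marked_def Let_def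
    by (intro prim_intros prim_defined_upto prim_marked_digit f k prim_comp[OF d] prim_comp[OF k])
qed

lemma defined_upto_modulus:
  assumes "approximates f p z"
  shows "defined_upto f k (initial p (modulus f p k))"
  unfolding modulus_def
proof (rule LeastI_ex)
  show "\<exists>l. defined_upto f k (initial p l)"
    using approximates_eventually_all[OF assms, of "Suc k"] unfolding defined_upto_def by fastforce
qed

lemma modulus_le: "defined_upto f k (initial p l) \<Longrightarrow> modulus f p k \<le> l"
  unfolding modulus_def by (rule Least_le)

lemma modulus_mono:
  assumes "approximates f p z" "j \<le> k"
  shows "modulus f p j \<le> modulus f p k"
  using defined_upto_modulus[OF assms(1), of k] assms(2)
  by (intro modulus_le) (auto simp: defined_upto_def)

lemma approximates_modulus:
  assumes "approximates f p z"
  shows "f (initial p (modulus f p k)) k = Some (z k)"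
  using defined_upto_modulus[OF assms, of k] approximates_sound[OF assms]
  unfolding defined_upto_def by (metis lessI option.exhaust)

lemma approximates_marked:
  assumes "approximates f p z"
  shows "approximates (marked f) p (\<lambda>k. marked_digit k (initial p (modulus f p k)) (z k))"
proof -
  have "marked f (initial p n) k = Some (marked_digit k (initial p (modulus f p k)) (z k))"
    if n: "modulus f p k \<le> n" for n k
  proof -
    have "(LEAST l. defined_upto f k (take l (initial p n)) \<or> n \<le> l) = modulus f p k"
    proof (rule Least_equality)
      show "defined_upto f k (take (modulus f p k) (initial p n)) \<or> n \<le> modulus f p k"
        using defined_upto_modulus[OF assms] n by (simp add: take_initial)
    next
      fix l assume "defined_upto f k (take l (initial p n)) \<or> n \<le> l"
      then show "modulus f p k \<le> l"
        using n modulus_le[of f k p l] by (cases "l \<le> n") (auto simp: take_initial)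
    qed
    then show ?thesis
      using n defined_upto_modulus[OF assms] approximates_modulus[OF assms]
      by (simp add: marked_def take_initial)
  qed
  moreover have "marked f (initial p n) k = None" if "n < modulus f p k" for n k
  proof -
    have "\<not> defined_upto f k (take l (initial p n))" for l
      using modulus_le[of f k p "min l n"] that
      by (cases "l \<le> n") (auto simp: take_initial)
    then show ?thesis
      by (simp add: marked_def Let_def)
  qed
  ultimately show ?thesis
    unfolding approximates_def by (metis not_le)
qed

section \<open>From marked digits to the ordinal-bounded representation\<close>

lemma after_last_not_mem: "finite I \<Longrightarrow> after_last I + n \<notin> I"
  unfolding after_last_def by (auto dest: Max_ge)

text \<open>Marks are odd exactly at the zeros of \<open>z\<close>, so both maps cut at the same
  place. By \<open>modulus_mono\<close> the segment of a later zero extends that of an earlier one.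
  As \<open>child\<close> may skip zeros in between, any two marks are directly related and their
  ranks decrease.\<close>

lemma Lmap_marked:
  assumes z: "approximates f (bpair t s) z" "finite {k. z k = 0}"
    and wf: "wf {(w, v). mind_changes f t v w}"
  shows "Lmap (rank (mind_changes f t))
      (\<lambda>k. marked_digit k (initial (bpair t s) (modulus f (bpair t s) k)) (z k)) = Delta z"
proof -
  define e where "e k = initial (bpair t s) (modulus f (bpair t s) k)" for k
  define q where "q k = marked_digit k (e k) (z k)" for k
  have odd: "odd (q k) \<longleftrightarrow> z k = 0" for k
    by (simp add: q_def marked_digit_def)
  have node: "i = prod_encode (k, list_encode (e k)) \<and> z k = 0" if "q k = 2 * i + 1" for k i
    using that odd[of k] by (simp add: q_def marked_digit_def)
  have "rank (mind_changes f t) i > rank (mind_changes f t) j"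
    if "n < m" "q n = 2 * i + 1" "q m = 2 * j + 1" for n m i j
  proof (rule rank_less[OF wf])
    have "modulus f (bpair t s) n \<le> modulus f (bpair t s) m"
      using modulus_mono[OF z(1)] that(1) by simp
    then show "mind_changes f t i j"
      using node[OF that(2)] node[OF that(3)] that(1) approximates_modulus[OF z(1), of m]
      by (simp add: child_def e_def take_initial lookup_initial bpair_def)
  qed
  moreover have "q (after_last {k. z k = 0} + n) div 2 = z (after_last {k. z k = 0} + n) - 1" for n
    using after_last_not_mem[OF z(2), of n] by (simp add: q_def marked_digit_def)
  ultimately have "Lmap (rank (mind_changes f t)) q = Delta z"
    using z(2) by (simp add: Lmap_def Delta_def odd)
  then show ?thesis
    by (simp add: q_def[abs_def] e_def[abs_def])
qed

theorem theorem66: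
  fixes X :: "'a rep_space" and Y :: "'b rep_space"
  assumes "complete_space X"
  shows "(\<forall>f \<in> points (HK_source X Y). HK X Y f \<noteq> {}) \<and>
    mv_computable (HK_source X Y) (HK_target X Y) (HK X Y)"
proof -
  obtain X' where X': "dom X' = UNIV" "rep_equivalent X X'"
    using assms by (auto simp: complete_space_def)
  obtain G where G: "computable G"
    "\<And>p x. X p = Some x \<Longrightarrow> \<exists>q. G p = Some q \<and> X' q = Some x"
    using X'(2) unfolding rep_equivalent_def mv_computable_def by force
  obtain H where H: "computable H"
    "\<And>p x. X' p = Some x \<Longrightarrow> \<exists>q. H p = Some q \<and> X q = Some x"
    using X'(2) unfolding rep_equivalent_def mv_computable_def by force
  obtain g where "G \<subseteq>\<^sub>m Phi g"
    using G(1) by (auto simp: computable_def)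
  then have g: "\<exists>s. Phi g r = Some s" if "X r = Some x" for r x
    using G(2)[OF that] by (auto simp: map_le_def dom_def)
  obtain h where "H \<subseteq>\<^sub>m Phi h"
    using H(1) by (auto simp: computable_def)
  then have h: "\<exists>q. Phi h p = Some q \<and> X q = Some x" if "X' p = Some x" for p x
    using H(2)[OF that] by (auto simp: map_le_def dom_def)
  have "prim (\<lambda>z. rank_digit (applied h) (fst z) (snd z))"
    by (intro prim_intros)
  then obtain m where m: "approximates (rank_digit (applied h)) p q \<Longrightarrow> Phi m p = Some q" for p q
    using approximates_Phi by meson
  \<comment> \<open>Replaces the \<open>X\<close>-name \<open>r\<close> in the oracle by an
    \<open>X'\<close>-name \<open>s\<close> of the same point, because the tree is built over
    \<open>X'\<close>-names. \<open>applied h\<close> translates \<open>s\<close> back into an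
    \<open>X\<close>-name, possibly different from \<open>r\<close>.\<close>
  define input where "input e k = (if even k then lookup e (2 * (k div 2))
    else univ g (prefix_of (\<lambda>e k. lookup e (Suc (2 * k))) e) (k div 2))" for e k
  have "prim (\<lambda>z. marked (applied h) (prefix_of input (fst z)) (snd z))"
    unfolding input_def by (intro prim_intros)
  then obtain m' where m': "approximates (\<lambda>e. marked (applied h) (prefix_of input e)) p q \<Longrightarrow>
      Phi m' p = Some q" for p q
    using approximates_Phi[of "\<lambda>e. marked (applied h) (prefix_of input e)"] by meson
  \<comment> \<open>Only the constant headers of \<open>m\<close> and \<open>m'\<close> are put in
    front of two copies of \<open>t\<close>.\<close>
  let ?names = "\<lambda>e k. if even k then fname_digit m e (k div 2) else fname_digit m' e (k div 2)"
  have "prim (\<lambda>z. ?names (fst z) (snd z))"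
    by (intro prim_intros)
  then obtain N where "approximates ?names p q \<Longrightarrow> Phi N p = Some q" for p q
    using approximates_Phi[of ?names] by blast
  then have N: "Phi N t = Some (bpair (fname m t) (fname m' t))" for t
    using approximates_bpair[OF approximates_fname approximates_fname] by blast
  have main: "\<exists>\<alpha>. HK_target X Y (bpair (fname m t) (fname m' t)) = Some (\<alpha>, f)"
    if "HK_source X Y t = Some f" for t f
  proof -
    have f: "cont_names X (nabla Y) t f"
      using that by (simp add: HK_source_def cont_space_eq_Some_iff)
    then obtain n p where t: "t = fname n p"
      and real: "realizes (\<lambda>r. Phi n (bpair p r)) X (nabla Y) f"
      by (auto simp: cont_names_def)
    have evaluates: "\<exists>z. approximates (applied h) (bpair t s) z \<and> nabla Y z = Some (f x)"
      if "X' s = Some x" for s x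
    proof -
      obtain r where r: "Phi h s = Some r" "X r = Some x"
        using h[OF \<open>X' s = Some x\<close>] by blast
      obtain z where "Phi n (bpair p r) = Some z" "nabla Y z = Some (f x)"
        using real r(2) unfolding realizes_def by blast
      then show ?thesis
        using approximates_applied[OF r(1)] t by blast
    qed
    have finite: "finite {k. z k = 0}" if "nabla Y z = Some y" for z y
      using that by (auto simp: nabla_def map_comp_def Delta_def split: option.splits if_splits)
    have wf: "wf {(w, v). mind_changes (applied h) t v w}"
    proof (rule wf_mind_changes)
      fix s
      obtain x where "X' s = Some x"
        using X'(1) by blast
      then show "\<exists>z. approximates (applied h) (bpair t s) z \<and> finite {k. z k = 0}"
        using evaluates finite by blast
    qed
    define \<alpha> where "\<alpha> = rank (mind_changes (applied h) t)"
    have "cont_names nat_space cord_space (fname m t) \<alpha>"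
    proof -
      have "realizes (\<lambda>r. Phi m (bpair t r)) nat_space cord_space \<alpha>"
        unfolding realizes_def \<alpha>_def nat_space_def
        using m[OF approximates_rank_digit] nK_rank[OF wf] by (auto simp: cord_space_eq_Some_iff)
      moreover have "points nat_space = UNIV"
        by (auto simp: nat_space_def ran_def)
      ultimately show ?thesis
        by (auto simp: cont_names_def points_cord_space PiE_def)
    qed
    moreover have "cont_names X (Lspace \<alpha> Y) (fname m' t) f"
    proof -
      have real: "realizes (\<lambda>r. Phi m' (bpair t r)) X (Lspace \<alpha> Y) f"
        unfolding realizes_def
      proof (intro allI impI)
        fix r x assume "X r = Some x"
        then obtain s where s: "Phi g r = Some s" "X' s = Some x"
          using g G(2) \<open>G \<subseteq>\<^sub>m Phi g\<close> by (metis domI map_le_def)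
        obtain z where z: "approximates (applied h) (bpair t s) z" "nabla Y z = Some (f x)"
          using evaluates[OF s(2)] by blast
        define q where "q k = marked_digit k (initial (bpair t s) (modulus (applied h) (bpair t s) k)) (z k)" for k
        have "approximates input (bpair t r) (bpair t s)"
          unfolding input_def[abs_def]
          by (intro approximates_bpair approximates_bfst
              approximates_comp[OF approximates_bsnd univ_approximates[OF s(1)]])
        then have "Phi m' (bpair t r) = Some q"
          unfolding q_def[abs_def] by (rule m'[OF approximates_comp[OF _ approximates_marked[OF z(1)]]])
        moreover have "Lspace \<alpha> Y q = Some (f x)"
          using Lmap_marked[OF z(1) finite[OF z(2)] wf] z(2)
          by (simp add: Lspace_def nabla_def map_comp_def \<alpha>_def q_def[abs_def])
        ultimately show "\<exists>q. Phi m' (bpair t r) = Some q \<and> Lspace \<alpha> Y q = Some (f x)"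
          by blast
      qed
      have "f x \<in> points (Lspace \<alpha> Y)" if "x \<in> points X" for x
        using that real unfolding realizes_def ran_def by blast
      moreover have "f \<in> extensional (points X)"
        using f by (simp add: cont_names_def PiE_def)
      ultimately show ?thesis
        using real by (auto simp: cont_names_def PiE_def)
    qed
    ultimately show ?thesis
      by (auto simp: HK_target_def sum_space_def cont_space_eq_Some_iff[symmetric] split: option.split)
  qed
  then have HK: "\<exists>\<alpha>. HK_target X Y (bpair (fname m t) (fname m' t)) = Some (\<alpha>, f) \<and> (\<alpha>, f) \<in> HK X Y f"
    if "HK_source X Y t = Some f" for t f
    using that unfolding HK_def by (blast intro: ranI)
  have "HK X Y f \<noteq> {}" if "f \<in> points (HK_source X Y)" for f
    using that HK unfolding ran_def by blast
  moreover have "mv_computable (HK_source X Y) (HK_target X Y) (HK X Y)"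
    unfolding mv_computable_def
  proof (intro exI[of _ "Phi N"] conjI allI impI)
    show "computable (Phi N)"
      unfolding computable_def by (intro exI[of _ N]) simp
  next
    fix t f assume "HK_source X Y t = Some f"
    from HK[OF this] show "\<exists>q y. Phi N t = Some q \<and> HK_target X Y q = Some y \<and> y \<in> HK X Y f"
      using N by blast
  qed
  ultimately show ?thesis
    by blast
qed

end
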